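(* There exist static, spherically symmetric, asymptotically flat solutions $(\mu,\lambda,f)$ of the massless Einstein–Vlasov system, with regular center and with compactly supported matter quantities $\varrho$, $p$, $p_T$. These solutions have the property that \[ \frac{4}{5}<\sup_{r\in[0,\infty)}\frac{2m(r)}{r}<\frac{8}{9}, \] where $m(r)=4\pi\int_0^r s^2\varrho(s)\,\mathrm ds$.
   Context: Units with $c=G=1$. A static spherically symmetric spacetime is described in Schwarzschild coordinates by the metric $g=-e^{2\mu(r)}\mathrm dt^2+e^{2\lambda(r)}\mathrm dr^2+r^2(\mathrm d\vartheta^2+\sin^2\vartheta\,\mathrm d\varphi^2)$, $r\in[0,\infty)$. The massless static Einstein–Vlasov system consists of the Einstein equations $e^{-2\lambda}(2r\lambda'-1)+1=8\pi r^2\varrho(r)$, $e^{-2\lambda}(2r\mu'+1)-1=8\pi r^2 p(r)$, together with the regular-center condition $\lambda(0)=0$, asymptotic flatness $\lim_{r\to\infty}\mu(r)=\lim_{r\to\infty}\lambda(r)=0$, and the static Vlasov equation for a particle density $f(x,v)\ge 0$, $x\in\mathbb R^3$, $v\in\mathbb R^3\setminus\{0\}$ (momenta of massless particles in an orthonormal frame, $|v|=\sqrt{\delta_{ab}v^av^b}$), spherically symmetric in the sense $f(Ax,Av)=f(x,v)$ for $A\in SO(3)$: $\frac{e^{\mu-\lambda}}{|v|}v^a\partial_{x^a}f-e^{\mu-\lambda}\frac{x^a}{r}|v|\mu'\partial_{v^a}f=0$, with $r=|x|$. The matter quantities are $\varrho(r)=\int f|v|\,\mathrm dv$, $p(r)=\int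 \frac{f}{|v|}\big(\frac{x\cdot v}{r}\big)^2\mathrm dv$, $p_T(r)=\frac12\int\big|\frac{x\times v}{r}\big|^2\frac{f}{|v|}\mathrm dv$ (integrals over $\mathbb R^3\setminus\{0\}$). $m(r)$ is the Hawking mass. *)

theory Defs
  imports "HOL-Analysis.Analysis"
begin

type_synonym pdens = "real^3 \<Rightarrow> real^3 \<Rightarrow> real"

text \<open>Matter quantities at a spatial point x (integrals over momentum space R^3;
  the null set {0} is irrelevant for the Lebesgue integral).\<close>
definition rho :: "pdens \<Rightarrow> real^3 \<Rightarrow> real" where
  "rho f x = integral\<^sup>L lborel (\<lambda>v. f x v * norm v)"

definition prad :: "pdens \<Rightarrow> real^3 \<Rightarrow> real" where
  "prad f x = integral\<^sup>L lborel (\<lambda>v. f x v / norm v * ((x \<bullet> v) / norm x)\<^sup>2)"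

definition ptan :: "pdens \<Rightarrow> real^3 \<Rightarrow> real" where
  "ptan f x = 1/2 * integral\<^sup>L lborel
      (\<lambda>v. (norm (cross3 x v) / norm x)\<^sup>2 * f x v / norm v)"

text \<open>Radial profile of rho (well defined by spherical symmetry) and the mass function.\<close>
definition rho_r :: "pdens \<Rightarrow> real \<Rightarrow> real" where
  "rho_r f r = rho f (axis 1 r)"

definition mass :: "pdens \<Rightarrow> real \<Rightarrow> real" where
  "mass f r = 4 * pi * integral {0..r} (\<lambda>s. s\<^sup>2 * rho_r f s)"

definition static_massless_EV :: "(real \<Rightarrow> real) \<Rightarrow> (real \<Rightarrow> real) \<Rightarrow> pdens \<Rightarrow> bool" where
  "static_massless_EV mu lam f \<longleftrightarrow>
     \<comment> \<open>regularity of the metric functions\<close>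
     continuous_on {0..} mu \<and> continuous_on {0..} lam \<and>
     (\<forall>r>0. mu differentiable at r) \<and> (\<forall>r>0. lam differentiable at r) \<and>
     \<comment> \<open>nonnegativity and spherical symmetry of f\<close>
     (\<forall>x v. v \<noteq> 0 \<longrightarrow> f x v \<ge> 0) \<and>
     (\<forall>A x v. rotation_matrix A \<longrightarrow> f (A *v x) (A *v v) = f x v) \<and>
     \<comment> \<open>the matter quantities are well defined (integrable)\<close>
     (\<forall>x. integrable lborel (\<lambda>v. f x v * norm v)) \<and>
     (\<forall>x. integrable lborel (\<lambda>v. f x v / norm v * ((x \<bullet> v) / norm x)\<^sup>2)) \<and>
     (\<forall>x. integrable lborel (\<lambda>v. (norm (cross3 x v) / norm x)\<^sup>2 * f x v / norm v)) \<and>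
     \<comment> \<open>Einstein equations\<close>
     (\<forall>x. norm x > 0 \<longrightarrow>
        exp (-2 * lam (norm x)) * (2 * norm x * deriv lam (norm x) - 1) + 1
          = 8 * pi * (norm x)\<^sup>2 * rho f x) \<and>
     (\<forall>x. norm x > 0 \<longrightarrow>
        exp (-2 * lam (norm x)) * (2 * norm x * deriv mu (norm x) + 1) - 1
          = 8 * pi * (norm x)\<^sup>2 * prad f x) \<and>
     \<comment> \<open>static Vlasov equation (classical sense), x \<noteq> 0, v \<noteq> 0\<close>
     (\<forall>x v. x \<noteq> 0 \<longrightarrow> v \<noteq> 0 \<longrightarrow>
        (\<exists>D. ((\<lambda>z. f (fst z) (snd z)) has_derivative D) (at (x, v)) \<and>
             D ((exp (mu (norm x) - lam (norm x)) / norm v) *\<^sub>R v,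
                (- (exp (mu (norm x) - lam (norm x)) * norm v * deriv mu (norm x) / norm x))
                   *\<^sub>R x) = 0)) \<and>
     \<comment> \<open>regular center and asymptotic flatness\<close>
     lam 0 = 0 \<and> (mu \<longlongrightarrow> 0) at_top \<and> (lam \<longlongrightarrow> 0) at_top"

end

theory Submission
  imports Defs
begin

text \<open>The photon density is a function of the energy \<open>E\<close> and the squared angular momentum \<open>L\<close>, hence
  solves the Vlasov equation: \<open>f\<close> is proportional to \<open>E (L - E\<^sup>2)\<^bsub>+\<^esub>\<^bsup>3/2\<^esup> (1 - L)\<^bsub>+\<^esub>\<^sup>2\<close>, where
  \<open>E\<^sup>2 = A(r) \<bar>v\<bar>\<^sup>2\<close> and \<open>A = e\<^bsup>2\<mu>\<^esup>\<close> up to a constant factor. Matter occupies only the region where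
  \<open>\<beta> = 1 - A/r\<^sup>2\<close> is positive. By a linear substitution in momentum space, with a constant \<open>K\<close>
  proportional to the amplitude of \<open>f\<close>,
  \<open>8\<pi>r\<^sup>2p = K\<beta>\<^sup>3/A\<close> and \<open>8\<pi>r\<^sup>2\<rho> = K\<beta>\<^sup>2(6 - 5\<beta>)/A\<close>, so the Einstein equations become an ODE system
  for \<open>A\<close> and \<open>y = 2m/r\<close>, started at the inner radius \<open>r = 1\<close> with \<open>A = 1\<close>, \<open>y = 0\<close>.

  With \<open>u = (1 - y)\<^bsup>1/2\<^esup>\<close> and \<open>P = 8\<pi>r\<^sup>2p\<close>, the Buchdahl-type quantity \<open>Q = (P + 1 + 3u\<^sup>2)/u\<close>
  satisfies an equation without \<open>\<rho>\<close>, which gives \<open>4 - 8(r - 1) \<le> Q \<le> 4\<close> and thus \<open>y < 8/9\<close>.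
  For large \<open>K\<close> the shell is thin: bounded pressure makes \<open>\<beta>\<close> tiny, so the density is huge unless
  \<open>u\<close> is close to \<open>1\<close> or to \<open>1/3\<close>; \<open>u\<close> cannot stay near \<open>1\<close>, where \<open>\<beta>\<close> grows at unit rate, and near
  \<open>1/3\<close> it decreases to zero at once. At that radius \<open>P = 0\<close>, \<open>Q\<close> is close to \<open>4\<close> and \<open>u\<close> close to \<open>1/3\<close>,
  and the solution is continued by a Schwarzschild exterior.\<close>

section \<open>Global solutions of Lipschitz ODEs\<close>

text \<open>Clamping the argument with \<open>c\<close> makes the Picard iterates bounded continuous
  functions on the whole line, so Banach's theorem applies in the complete type of such functions
  and one fixed point covers all of \<open>{a..b}\<close>.\<close>

lemma picard_lindelof_global:
  fixes F :: "real \<Rightarrow> 'a::euclidean_space \<Rightarrow> 'a"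
  assumes cont: "continuous_on UNIV (\<lambda>(t, x). F t x)"
    and lip: "\<And>t x y. norm (F t x - F t y) \<le> L * norm (x - y)"
    and L: "0 < L" and ab: "a \<le> b"
  obtains x where "x a = x0"
    "\<And>t. t \<in> {a..b} \<Longrightarrow> (x has_vector_derivative F t (x t)) (at t within {a..b})"
proof -
  define c where "c = (\<lambda>t. max a (min b t))"
  have c_in: "c t \<in> {a..b}" for t using ab by (auto simp: c_def)
  have c_id: "c t = t" if "t \<in> {a..b}" for t using that by (auto simp: c_def)
  have c_cont: "continuous_on S c" for S unfolding c_def by (intro continuous_intros)
  \<comment> \<open>the integral operator contracts \<open>z = x/w\<close> for this weight on all of \<open>{a..b}\<close>, however large \<open>L\<close>\<close>
  define w where "w = (\<lambda>t. exp (2 * L * (t - a)))"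
  have w_pos: "w t > 0" for t by (simp add: w_def)
  have w_cont: "continuous_on S w" for S unfolding w_def by (intro continuous_intros)
  define g where "g = (\<lambda>(z :: real \<Rightarrow>\<^sub>C 'a) t. F t (w t *\<^sub>R z t))"
  have g_cont: "continuous_on S (g z)" for S z
  proof -
    have "continuous_on S (\<lambda>t. (t, w t *\<^sub>R apply_bcontfun z t))"
      by (intro continuous_intros w_cont) simp
    from continuous_on_compose2[OF cont this] show ?thesis by (simp add: g_def)
  qed
  have g_int: "g z integrable_on {a..t}" for z t
    by (rule integrable_continuous_real) (rule g_cont)
  define T where "T = (\<lambda>z t. (x0 + integral {a..c t} (g z)) /\<^sub>R w (c t))"
  have T_cont: "continuous_on UNIV (T z)" for z
  proof -
    have "continuous_on {a..b} (\<lambda>t. integral {a..t} (g z))"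
      by (rule indefinite_integral_continuous_1) (rule g_int)
    then have "continuous_on UNIV (\<lambda>t. integral {a..c t} (g z))"
      using c_in by (intro continuous_on_compose2[OF _ c_cont]) auto
    moreover have "continuous_on UNIV (\<lambda>t. w (c t))"
      by (rule continuous_on_compose2[OF w_cont[of UNIV] c_cont]) auto
    ultimately show ?thesis unfolding T_def
      using w_pos by (intro continuous_intros) (auto simp: less_imp_neq[symmetric])
  qed
  have T_bcontfun: "T z \<in> bcontfun" for z
  proof -
    have "compact (T z ` {a..b})"
      by (intro compact_continuous_image continuous_on_subset[OF T_cont]) auto
    moreover have "T z t \<in> T z ` {a..b}" for t
      by (rule image_eqI[of _ _ "c t"]) (use c_in c_id in \<open>auto simp: T_def\<close>)
    ultimately have "bounded (range (T z))"
      by (meson bounded_subset compact_imp_bounded image_subsetI)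
    with T_cont show ?thesis by (simp add: bcontfun_def)
  qed
  have "\<exists>!z. Bcontfun (T z) = z"
  proof (rule banach_fix_type[of "1/2"]; (intro allI)?)
    fix z z' :: "real \<Rightarrow>\<^sub>C 'a"
    show "dist (Bcontfun (T z)) (Bcontfun (T z')) \<le> 1/2 * dist z z'"
    proof (rule dist_bound, unfold Bcontfun_inverse[OF T_bcontfun])
      fix t
      let ?s = "c t" and ?d = "dist z z'"
      \<comment> \<open>Integrating the weight gains the factor \<open>1 / (2 * L)\<close>, which
        turns the Lipschitz constant into the contraction constant 1/2.\<close>
      have w_int: "((\<lambda>\<tau>. L * ?d * w \<tau>) has_integral ?d / 2 * w ?s - ?d / 2 * w a) {a..?s}"
        using c_in[of t] L unfolding w_def
        by (intro fundamental_theorem_of_calculus)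
          (auto intro!: derivative_eq_intros simp: has_real_derivative_iff_has_vector_derivative[symmetric])
      have "norm (integral {a..?s} (\<lambda>\<tau>. g z \<tau> - g z' \<tau>)) \<le> integral {a..?s} (\<lambda>\<tau>. L * ?d * w \<tau>)"
      proof (rule integral_norm_bound_integral)
        fix \<tau>
        have "norm (g z \<tau> - g z' \<tau>) \<le> L * norm (w \<tau> *\<^sub>R z \<tau> - w \<tau> *\<^sub>R z' \<tau>)"
          unfolding g_def by (rule lip)
        also have "\<dots> = L * (w \<tau> * dist (z \<tau>) (z' \<tau>))"
          using w_pos[of \<tau>] by (simp add: dist_norm scaleR_diff_right[symmetric])
        also have "\<dots> \<le> L * (w \<tau> * ?d)"
          using L w_pos[of \<tau>] by (intro mult_left_mono dist_bounded) auto
        finally show "norm (g z \<tau> - g z' \<tau>) \<le> L * ?d * w \<tau>" by (simp add: mult_ac)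
      qed (use g_int w_int in \<open>auto intro: integrable_diff\<close>)
      also have "\<dots> \<le> ?d / 2 * w ?s"
        using integral_unique[OF w_int] w_pos[of a] by simp
      finally have le: "norm (integral {a..?s} (g z) - integral {a..?s} (g z')) \<le> ?d / 2 * w ?s"
        by (simp add: integral_diff[OF g_int g_int])
      have "dist (T z t) (T z' t) = norm (integral {a..?s} (g z) - integral {a..?s} (g z')) / w ?s"
        using w_pos[of ?s] by (simp add: T_def dist_norm scaleR_diff_right[symmetric] divide_inverse mult.commute)
      also have "\<dots> \<le> 1/2 * ?d"
        using le w_pos[of ?s] by (simp add: field_simps)
      finally show "dist (T z t) (T z' t) \<le> 1/2 * ?d" .
    qed
  qed auto
  then obtain z where "Bcontfun (T z) = z" by blast
  then have Tz: "T z t = z t" for t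
    using Bcontfun_inverse[OF T_bcontfun, of z] by simp
  define x where "x = (\<lambda>t. x0 + integral {a..t} (g z))"
  have wz: "w t *\<^sub>R z t = x t" if "t \<in> {a..b}" for t
    using Tz[of t] w_pos[of t] c_id[OF that] by (simp add: T_def x_def flip: Tz)
  show thesis
  proof
    show "x a = x0" by (simp add: x_def)
    fix t assume t: "t \<in> {a..b}"
    have "((\<lambda>t. integral {a..t} (g z)) has_vector_derivative g z t) (at t within {a..b})"
      by (rule integral_has_vector_derivative[OF g_cont t])
    from has_vector_derivative_add[OF has_vector_derivative_const this]
    show "(x has_vector_derivative F t (x t)) (at t within {a..b})"
      using wz[OF t] by (simp add: x_def g_def)
  qed
qed

section \<open>Bounded Lipschitz functions and planar systems\<close>

definition bounded_lipschitz :: "('a::metric_space \<Rightarrow> real) \<Rightarrow> bool" where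
  "bounded_lipschitz f \<longleftrightarrow> bounded (range f) \<and> (\<exists>L. L-lipschitz_on UNIV f)"

lemma bounded_lipschitzE:
  assumes "bounded_lipschitz f"
  obtains M L where "0 < M" "0 \<le> L" "\<And>x. \<bar>f x\<bar> \<le> M" "\<And>x y. \<bar>f x - f y\<bar> \<le> L * dist x y"
  using assms unfolding bounded_lipschitz_def bounded_pos lipschitz_on_def
  by (force simp: dist_real_def)

lemma bounded_lipschitzI:
  assumes "\<And>x. \<bar>f x\<bar> \<le> M" "\<And>x y. \<bar>f x - f y\<bar> \<le> L * dist x y"
  shows "bounded_lipschitz f"
proof -
  have "\<bar>f x - f y\<bar> \<le> max 0 L * dist x y" for x y
    by (rule order_trans[OF assms(2)]) (intro mult_right_mono, auto)
  then show ?thesis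
  unfolding bounded_lipschitz_def bounded_iff lipschitz_on_def dist_real_def
  using assms(1) by (intro conjI exI[of _ "max 0 L"] exI[of _ M]) auto
qed

lemma bounded_lipschitz_const: "bounded_lipschitz (\<lambda>x. c)"
  by (rule bounded_lipschitzI[of _ "\<bar>c\<bar>" 0]) auto

lemma bounded_lipschitz_add:
  assumes "bounded_lipschitz f" "bounded_lipschitz g"
  shows "bounded_lipschitz (\<lambda>x. f x + g x)"
proof -
  obtain M L where f: "\<And>x. \<bar>f x\<bar> \<le> M" "\<And>x y. \<bar>f x - f y\<bar> \<le> L * dist x y"
    by (rule bounded_lipschitzE[OF assms(1)]) blast
  obtain M' L' where g: "\<And>x. \<bar>g x\<bar> \<le> M'" "\<And>x y. \<bar>g x - g y\<bar> \<le> L' * dist x y"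
    by (rule bounded_lipschitzE[OF assms(2)]) blast
  show ?thesis
  proof (rule bounded_lipschitzI[of _ "M + M'" "L + L'"])
    show "\<bar>f x + g x\<bar> \<le> M + M'" for x using f(1)[of x] g(1)[of x] by linarith
    show "\<bar>f x + g x - (f y + g y)\<bar> \<le> (L + L') * dist x y" for x y
      using f(2)[of x y] g(2)[of x y] by (simp add: distrib_right)
  qed
qed

text \<open>The sup bounds enter here: the product estimate needs both factors bounded. This is why
  boundedness is part of the class, which is thereby closed under the operations that build the
  truncated right-hand sides.\<close>

lemma bounded_lipschitz_mult:
  assumes "bounded_lipschitz f" "bounded_lipschitz g"
  shows "bounded_lipschitz (\<lambda>x. f x * g x)"
proof -
  obtain M L where f: "0 < M" "\<And>x. \<bar>f x\<bar> \<le> M" "0 \<le> L" "\<And>x y. \<bar>f x - f y\<bar> \<le> L * dist x y"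
    by (rule bounded_lipschitzE[OF assms(1)]) blast
  obtain M' L' where g: "0 < M'" "\<And>x. \<bar>g x\<bar> \<le> M'" "0 \<le> L'" "\<And>x y. \<bar>g x - g y\<bar> \<le> L' * dist x y"
    by (rule bounded_lipschitzE[OF assms(2)]) blast
  show ?thesis
  proof (rule bounded_lipschitzI[of _ "M * M'" "M * L' + L * M'"])
    show "\<bar>f x * g x\<bar> \<le> M * M'" for x
      using f g by (simp add: abs_mult mult_mono less_imp_le)
    fix x y
    have "f x * g x - f y * g y = f x * (g x - g y) + (f x - f y) * g y"
      by (simp add: algebra_simps)
    then have "\<bar>f x * g x - f y * g y\<bar> \<le> \<bar>f x\<bar> * \<bar>g x - g y\<bar> + \<bar>f x - f y\<bar> * \<bar>g y\<bar>"
      by (metis abs_mult abs_triangle_ineq)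
    also have "\<dots> \<le> M * (L' * dist x y) + (L * dist x y) * M'"
      using f g by (intro add_mono mult_mono) (auto simp: less_imp_le)
    finally show "\<bar>f x * g x - f y * g y\<bar> \<le> (M * L' + L * M') * dist x y"
      by (simp add: algebra_simps)
  qed
qed

lemma bounded_lipschitz_diff:
  assumes "bounded_lipschitz f" "bounded_lipschitz g"
  shows "bounded_lipschitz (\<lambda>x. f x - g x)"
  using bounded_lipschitz_add[OF assms(1) bounded_lipschitz_mult[OF bounded_lipschitz_const[of "-1"] assms(2)]]
  by simp

lemma bounded_lipschitz_power:
  "bounded_lipschitz f \<Longrightarrow> bounded_lipschitz (\<lambda>x. f x ^ n)"
  by (induction n) (auto intro: bounded_lipschitz_const bounded_lipschitz_mult)

lemma bounded_lipschitz_inverse: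
  assumes "bounded_lipschitz f" "0 < m" "\<And>x. m \<le> f x"
  shows "bounded_lipschitz (\<lambda>x. inverse (f x))"
proof -
  obtain M L where f: "\<And>x y. \<bar>f x - f y\<bar> \<le> L * dist x y"
    by (rule bounded_lipschitzE[OF assms(1)]) blast
  have pos: "f x > 0" for x using assms(2) assms(3)[of x] by linarith
  show ?thesis
  proof (rule bounded_lipschitzI[of _ "1 / m" "L / (m * m)"])
    show "\<bar>inverse (f x)\<bar> \<le> 1 / m" for x
      using assms(2) assms(3)[of x] pos[of x] by (simp add: field_simps)
    fix x y
    have "inverse (f x) - inverse (f y) = (f y - f x) / (f x * f y)"
      using pos[of x] pos[of y] by (simp add: field_simps)
    then have "\<bar>inverse (f x) - inverse (f y)\<bar> = \<bar>f x - f y\<bar> / (f x * f y)"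
      using pos[of x] pos[of y] by (simp add: abs_minus_commute)
    also have "\<dots> \<le> (L * dist x y) / (m * m)"
      using f[of x y] assms(2) assms(3)[of x] assms(3)[of y] pos
      by (intro frac_le mult_mono) (auto intro: order_trans[OF abs_ge_zero] less_imp_le)
    finally show "\<bar>inverse (f x) - inverse (f y)\<bar> \<le> L / (m * m) * dist x y" by simp
  qed
qed

lemma bounded_lipschitz_max:
  assumes "bounded_lipschitz f"
  shows "bounded_lipschitz (\<lambda>x. max c (f x))"
proof -
  obtain M L where f: "\<And>x. \<bar>f x\<bar> \<le> M" "\<And>x y. \<bar>f x - f y\<bar> \<le> L * dist x y"
    by (rule bounded_lipschitzE[OF assms(1)]) blast
  show ?thesis
  proof (rule bounded_lipschitzI[of _ "M + \<bar>c\<bar>" L])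
    show "\<bar>max c (f x)\<bar> \<le> M + \<bar>c\<bar>" for x using f(1)[of x] by linarith
    show "\<bar>max c (f x) - max c (f y)\<bar> \<le> L * dist x y" for x y using f(2)[of x y] by linarith
  qed
qed

lemma bounded_lipschitz_clamp:
  assumes "\<And>x y. \<bar>f x - f y\<bar> \<le> dist x y"
  shows "bounded_lipschitz (\<lambda>x. max c (min d (f x)))"
proof (rule bounded_lipschitzI[of _ "\<bar>c\<bar> + \<bar>d\<bar>" 1])
  show "\<bar>max c (min d (f x))\<bar> \<le> \<bar>c\<bar> + \<bar>d\<bar>" for x by linarith
  show "\<bar>max c (min d (f x)) - max c (min d (f y))\<bar> \<le> 1 * dist x y" for x y
    using assms[of x y] by linarith
qed

lemmas bounded_lipschitz_intros =
  bounded_lipschitz_const bounded_lipschitz_add bounded_lipschitz_diff bounded_lipschitz_mult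
  bounded_lipschitz_power bounded_lipschitz_max

lemma bounded_lipschitz_ode:
  fixes f g :: "real \<times> real \<times> real \<Rightarrow> real"
  assumes "bounded_lipschitz f" "bounded_lipschitz g" "a \<le> b"
  obtains x y where "x a = x0" "y a = y0"
    "\<And>t. t \<in> {a..b} \<Longrightarrow> (x has_real_derivative f (t, x t, y t)) (at t within {a..b})"
    "\<And>t. t \<in> {a..b} \<Longrightarrow> (y has_real_derivative g (t, x t, y t)) (at t within {a..b})"
proof -
  define F where "F = (\<lambda>t z. (f (t, z), g (t, z)))"
  obtain L where f: "0 \<le> L" "\<And>x y. \<bar>f x - f y\<bar> \<le> L * dist x y"
    by (rule bounded_lipschitzE[OF assms(1)]) blast
  obtain L' where g: "0 \<le> L'" "\<And>x y. \<bar>g x - g y\<bar> \<le> L' * dist x y"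
    by (rule bounded_lipschitzE[OF assms(2)]) blast
  have "continuous_on UNIV f" "continuous_on UNIV g"
    using assms(1,2) by (auto simp: bounded_lipschitz_def lipschitz_on_continuous_on)
  then have "continuous_on UNIV (\<lambda>(t, z). F t z)"
    by (auto simp: F_def split_def intro!: continuous_intros)
  moreover have "norm (F t z - F t z') \<le> (L + L' + 1) * norm (z - z')" for t z z'
  proof -
    have "norm (F t z - F t z') \<le> \<bar>f (t, z) - f (t, z')\<bar> + \<bar>g (t, z) - g (t, z')\<bar>"
      by (simp add: F_def norm_Pair sqrt_sum_squares_le_sum_abs)
    also have "\<dots> \<le> L * dist (t, z) (t, z') + L' * dist (t, z) (t, z')"
      by (intro add_mono f g)
    also have "dist (t, z) (t, z') = norm (z - z')" by (simp add: dist_Pair_Pair dist_norm)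
    also have "L * norm (z - z') + L' * norm (z - z') \<le> (L + L' + 1) * norm (z - z')"
      by (simp add: distrib_right)
    finally show ?thesis .
  qed
  ultimately obtain z where z: "z a = (x0, y0)"
    "\<And>t. t \<in> {a..b} \<Longrightarrow> (z has_vector_derivative F t (z t)) (at t within {a..b})"
    by (rule picard_lindelof_global[of F "L + L' + 1" a b "(x0, y0)"]) (use f(1) g(1) assms(3) in auto)
  show thesis
  proof
    show "fst (z a) = x0" "snd (z a) = y0" using z(1) by auto
    fix t assume t: "t \<in> {a..b}"
    have "((\<lambda>t. fst (z t)) has_vector_derivative fst (F t (z t))) (at t within {a..b})"
      "((\<lambda>t. snd (z t)) has_vector_derivative snd (F t (z t))) (at t within {a..b})"
      using z(2)[OF t] by (auto simp: has_vector_derivative_def intro!: derivative_eq_intros)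
    then show "((\<lambda>t. fst (z t)) has_real_derivative f (t, fst (z t), snd (z t))) (at t within {a..b})"
      "((\<lambda>t. snd (z t)) has_real_derivative g (t, fst (z t), snd (z t))) (at t within {a..b})"
      by (auto simp: F_def has_real_derivative_iff_has_vector_derivative)
  qed
qed

section \<open>The shell equations\<close>

lemma mvt_within:
  fixes f :: "real \<Rightarrow> real"
  assumes "\<And>t. t \<in> {a..b} \<Longrightarrow> (f has_real_derivative f' t) (at t within {a..b})"
    and "a \<le> s" "s < t" "t \<le> b"
  obtains \<xi> where "s < \<xi>" "\<xi> < t" "f t - f s = f' \<xi> * (t - s)"
proof -
  have "(f has_derivative (\<lambda>h. f' x * h)) (at x within {s..t})" if "s \<le> x" "x \<le> t" for x
    using has_field_derivative_subset[OF assms(1), of x "{s..t}"] assms(2-) that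
    by (simp add: has_field_derivative_def)
  from mvt_simple[OF assms(3) this] show thesis using that by force
qed

lemma increment_ge:
  fixes f :: "real \<Rightarrow> real"
  assumes "\<And>t. t \<in> {a..b} \<Longrightarrow> (f has_real_derivative f' t) (at t within {a..b})"
    and "a \<le> s" "s \<le> t" "t \<le> b" "\<And>\<xi>. s < \<xi> \<Longrightarrow> \<xi> < t \<Longrightarrow> c \<le> f' \<xi>"
  shows "c * (t - s) \<le> f t - f s"
proof (cases "s = t")
  case False
  then have "s < t" using assms by simp
  from mvt_within[OF assms(1,2) this assms(4)] obtain \<xi>
    where "s < \<xi>" "\<xi> < t" "f t - f s = f' \<xi> * (t - s)" .
  then show ?thesis using assms(5) by (simp add: mult_right_mono)
qed simp

lemma increment_le:
  fixes f :: "real \<Rightarrow> real"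
  assumes "\<And>t. t \<in> {a..b} \<Longrightarrow> (f has_real_derivative f' t) (at t within {a..b})"
    and "a \<le> s" "s \<le> t" "t \<le> b" "\<And>\<xi>. s < \<xi> \<Longrightarrow> \<xi> < t \<Longrightarrow> f' \<xi> \<le> c"
  shows "f t - f s \<le> c * (t - s)"
proof (cases "s = t")
  case False
  then have "s < t" using assms by simp
  from mvt_within[OF assms(1,2) this assms(4)] obtain \<xi>
    where "s < \<xi>" "\<xi> < t" "f t - f s = f' \<xi> * (t - s)" .
  then show ?thesis using assms(5) by (simp add: mult_right_mono)
qed simp

text \<open>Beyond the last point \<open>s\<close> up to \<open>t\<close> with
  \<open>f s <= c\<close> the derivative is nonpositive, so \<open>f\<close> cannot have climbed
  above \<open>c\<close>.\<close>

lemma barrier: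
  fixes f :: "real \<Rightarrow> real"
  assumes der: "\<And>t. t \<in> {a..b} \<Longrightarrow> (f has_real_derivative f' t) (at t within {a..b})"
    and "f a \<le> c" "\<And>t. t \<in> {a..b} \<Longrightarrow> c \<le> f t \<Longrightarrow> f' t \<le> 0" "t \<in> {a..b}"
  shows "f t \<le> c"
proof (rule ccontr)
  assume "\<not> f t \<le> c"
  have "continuous_on {a..t} f"
    using der assms(4) by (intro continuous_on_subset[OF DERIV_continuous_on[of "{a..b}"]]) auto
  then have c: "compact ({a..t} \<inter> f -` {..c})"
    by (simp add: compact_eq_bounded_closed continuous_closed_preimage bounded_Int)
  have ne: "{a..t} \<inter> f -` {..c} \<noteq> {}" using assms(2,4) by auto
  obtain s where "s \<in> {a..t} \<inter> f -` {..c}" "\<forall>x\<in>{a..t} \<inter> f -` {..c}. x \<le> s"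
    using compact_attains_sup[OF c ne] by blast
  then have s: "s \<in> {a..t}" "f s \<le> c" "\<And>x. x \<in> {a..t} \<Longrightarrow> f x \<le> c \<Longrightarrow> x \<le> s"
    by auto
  have "f t - f s \<le> 0 * (t - s)"
  proof (rule increment_le[OF der])
    fix x assume x: "s < x" "x < t"
    then have "\<not> f x \<le> c" using s(1) s(3)[of x] by force
    then show "f' x \<le> 0" using s(1) x assms(4) by (intro assms(3)) auto
  qed (use s(1) assms(4) in auto)
  then show False using s(2) \<open>\<not> f t \<le> c\<close> by simp
qed

lemma continuous_bootstrap:
  fixes z :: "real \<Rightarrow> 'a::t2_space"
  assumes "continuous_on {a..b} z" "open U"
    and step: "\<And>r. r \<in> {a..b} \<Longrightarrow> (\<And>s. a \<le> s \<Longrightarrow> s < r \<Longrightarrow> z s \<in> U) \<Longrightarrow> z r \<in> U"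
    and "t \<in> {a..b}"
  shows "z t \<in> U"
proof (rule ccontr)
  assume "z t \<notin> U"
  have c: "compact ({a..b} \<inter> z -` (- U))"
    using assms(1,2) by (simp add: compact_eq_bounded_closed continuous_closed_preimage bounded_Int closed_Compl)
  have ne: "{a..b} \<inter> z -` (- U) \<noteq> {}" using assms(4) \<open>z t \<notin> U\<close> by auto
  obtain r where "r \<in> {a..b} \<inter> z -` (- U)" "\<forall>x\<in>{a..b} \<inter> z -` (- U). r \<le> x"
    using compact_attains_inf[OF c ne] by blast
  then have r: "r \<in> {a..b}" "z r \<notin> U" "\<And>x. x \<in> {a..b} \<Longrightarrow> z x \<notin> U \<Longrightarrow> r \<le> x"
    by auto
  have "z s \<in> U" if "a \<le> s" "s < r" for s using r(3)[of s] r(1) that by auto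
  with step[OF r(1)] r(2) show False by blast
qed

text \<open>Only the kink at 0 is delicate: the limit hypothesis makes the right derivative 0,
  matching the constant left branch.\<close>

lemma DERIV_pos_part:
  fixes g g' :: "real \<Rightarrow> real"
  assumes "\<And>t. 0 < t \<Longrightarrow> (g has_real_derivative g' t) (at t)"
    and lim: "((\<lambda>t. g t / t) \<longlongrightarrow> 0) (at_right 0)" and 0: "g 0 = 0" "g' 0 = 0"
  shows "((\<lambda>x. g (max 0 x)) has_real_derivative g' (max 0 x)) (at x)"
proof -
  consider "x > 0" | "x = 0" | "x < 0" by linarith
  then show ?thesis
  proof cases
    case 1
    then have "((\<lambda>x. g (max 0 x)) has_real_derivative g' x) (at x)"
      by (intro has_field_derivative_transform_within_open[OF assms(1), of _ "{0<..}"]) auto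
    with 1 show ?thesis by (simp add: max_def)
  next
    case 2
    have "((\<lambda>h. g (max 0 h) / h) \<longlongrightarrow> 0) (at_right 0)"
      by (rule Lim_transform_eventually[OF lim]) (auto simp: eventually_at_right_less eventually_at_topological intro!: exI[of _ UNIV])
    moreover have "((\<lambda>h. g (max 0 h) / h) \<longlongrightarrow> 0) (at_left 0)"
      by (rule Lim_transform_eventually[OF tendsto_const])
        (auto simp: eventually_at_topological 0 max_def intro!: exI[of _ UNIV])
    ultimately have "((\<lambda>h. g (max 0 h) / h) \<longlongrightarrow> 0) (at 0)"
      by (simp add: filterlim_split_at)
    with 2 show ?thesis by (simp add: DERIV_def 0)
  next
    case 3
    have "((\<lambda>x::real. 0) has_real_derivative 0) (at x)" by simp
    then have "((\<lambda>x. g (max 0 x)) has_real_derivative 0) (at x)"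
      by (rule has_field_derivative_transform_within_open[of _ _ _ "{..<0}"]) (use 3 0 in auto)
    with 3 show ?thesis by (simp add: 0)
  qed
qed

lemma DERIV_pos_part_power:
  assumes "n \<ge> 2"
  shows "((\<lambda>x::real. (max 0 x) ^ n) has_real_derivative real n * (max 0 x) ^ (n - 1)) (at x)"
proof (rule DERIV_pos_part[of "\<lambda>t. t ^ n" "\<lambda>t. real n * t ^ (n - 1)"])
  have "((\<lambda>t::real. t ^ (n - 1)) \<longlongrightarrow> 0) (at_right 0)"
    using assms by (auto intro!: tendsto_eq_intros)
  then show "((\<lambda>t::real. t ^ n / t) \<longlongrightarrow> 0) (at_right 0)"
  proof (rule Lim_transform_eventually)
    have "t ^ (n - 1) = t ^ n / t" if "t > 0" for t :: real
      using assms that power_minus_mult[of n t] by (simp add: eq_divide_eq)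
    then show "\<forall>\<^sub>F t::real in at_right 0. t ^ (n - 1) = t ^ n / t"
      by (auto simp: eventually_at_topological intro!: exI[of _ UNIV])
  qed
qed (use assms in \<open>auto intro!: derivative_eq_intros simp: power_0_left\<close>)

section \<open>A priori bounds for the shell\<close>

locale shell =
  fixes A y :: "real \<Rightarrow> real" and K R :: real
  assumes K: "0 \<le> K" and R: "1 \<le> R" "R \<le> 101/100"
    and init: "A 1 = 1" "y 1 = 0"
    and range_A: "\<And>r. r \<in> {1..R} \<Longrightarrow> 1/2 \<le> A r \<and> A r \<le> 2"
    and range_y: "\<And>r. r \<in> {1..R} \<Longrightarrow> -1 \<le> y r \<and> y r \<le> 9/10"
    and ode_A: "\<And>r. r \<in> {1..R} \<Longrightarrow>
      (A has_real_derivative (K * (max 0 (1 - A r / r\<^sup>2)) ^ 3 + A r * y r) / ((1 - y r) * r))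
        (at r within {1..R})"
    and ode_y: "\<And>r. r \<in> {1..R} \<Longrightarrow>
      (y has_real_derivative
        (K * (max 0 (1 - A r / r\<^sup>2))\<^sup>2 * (6 - 5 * max 0 (1 - A r / r\<^sup>2)) / A r - y r) / r)
        (at r within {1..R})"
begin

text \<open>\<open>P\<close> and \<open>D\<close> are 8 pi r^2 times radial pressure and density.
  \<open>G\<close> equals 1 - r \<mu>', expressed by \<open>Q\<close> and \<open>u\<close> because
  these are the controlled quantities; its sign decides whether \<open>\<beta>\<close> grows, and
  for \<open>Q\<close> near 4 it changes at \<open>u\<close> near 2/3.\<close>

definition "\<beta> r = 1 - A r / r\<^sup>2"
definition "B r = max 0 (\<beta> r)"
definition "P r = K * B r ^ 3 / A r"
definition "D r = K * (B r)\<^sup>2 * (6 - 5 * B r) / A r"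
definition "u r = sqrt (1 - y r)"
definition "Q r = (P r + 4 - 3 * y r) / u r"
definition "G r = (6 * u r - Q r) / (2 * u r)"

lemma A_pos: "r \<in> {1..R} \<Longrightarrow> 0 < A r"
  using range_A[of r] by auto

lemma \<beta>_less_1: "r \<in> {1..R} \<Longrightarrow> \<beta> r < 1"
  using A_pos[of r] by (simp add: \<beta>_def)

lemma B_bounds: assumes "r \<in> {1..R}" shows "0 \<le> B r" "B r < 1"
  using \<beta>_less_1[OF assms] by (auto simp: B_def)

lemma P_nonneg: "r \<in> {1..R} \<Longrightarrow> 0 \<le> P r"
  using A_pos[of r] B_bounds[of r] K by (simp add: P_def)

lemma D_nonneg: "r \<in> {1..R} \<Longrightarrow> 0 \<le> D r"
  using A_pos[of r] B_bounds[of r] K by (simp add: D_def)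

lemma deriv_A: "r \<in> {1..R} \<Longrightarrow>
    (A has_real_derivative A r * (P r + y r) / ((1 - y r) * r)) (at r within {1..R})"
  using ode_A[of r] A_pos[of r] by (simp add: P_def B_def \<beta>_def distrib_left)

lemma deriv_y: "r \<in> {1..R} \<Longrightarrow> (y has_real_derivative (D r - y r) / r) (at r within {1..R})"
  using ode_y[of r] by (simp add: D_def B_def \<beta>_def)

lemma y_nonneg:
  assumes "r \<in> {1..R}"
  shows "0 \<le> y r"
proof -
  have "((\<lambda>r. r * y r) has_real_derivative D r) (at r within {1..R})" if "r \<in> {1..R}" for r
    using that by (auto intro!: derivative_eq_intros deriv_y)
  from increment_ge[OF this, of 1 r 0] D_nonneg assms init have "0 \<le> r * y r" by auto
  with assms show ?thesis by (simp add: zero_le_mult_iff)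
qed

lemma u_bounds: assumes "r \<in> {1..R}" shows "0 < u r" "u r \<le> 1" "(u r)\<^sup>2 = 1 - y r"
  using range_y[OF assms] y_nonneg[OF assms] by (auto simp: u_def)

lemma y_eq: "r \<in> {1..R} \<Longrightarrow> y r = 1 - (u r)\<^sup>2"
  using u_bounds(3)[of r] by simp

lemma P_eq: "r \<in> {1..R} \<Longrightarrow> P r = Q r * u r - 1 - 3 * (u r)\<^sup>2"
  using u_bounds[of r] by (simp add: Q_def)

lemma G_eq: assumes "r \<in> {1..R}" shows "G r = 1 - (P r + y r) / (2 * (1 - y r))"
  using u_bounds[OF assms]
  by (simp add: G_def P_eq[OF assms] y_eq[OF assms] field_simps power2_eq_square)

lemma deriv_u:
  assumes "r \<in> {1..R}"
  shows "(u has_real_derivative (y r - D r) / (2 * u r * r)) (at r within {1..R})"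
proof -
  have "1 - y r > 0" using range_y[OF assms] by auto
  then have "((\<lambda>r. sqrt (1 - y r)) has_real_derivative (y r - D r) / (2 * u r * r)) (at r within {1..R})"
    using assms u_bounds[OF assms]
    by (auto intro!: derivative_eq_intros deriv_y simp: u_def field_simps)
  then show ?thesis by (simp add: u_def[abs_def])
qed

lemma deriv_\<beta>:
  assumes "r \<in> {1..R}"
  shows "(\<beta> has_real_derivative 2 * (1 - \<beta> r) * G r / r) (at r within {1..R})"
proof -
  have "r > 0" "1 - y r > 0" using assms range_y[OF assms] by auto
  have sq: "((\<lambda>r. r\<^sup>2) has_real_derivative 2 * r) (at r within {1..R})"
    by (auto intro!: derivative_eq_intros)
  have d\<beta>: "(\<beta> has_real_derivative
      0 - (A r * (P r + y r) / ((1 - y r) * r) * r\<^sup>2 - A r * (2 * r)) / (r\<^sup>2 * r\<^sup>2)) (at r within {1..R})"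
    unfolding \<beta>_def[abs_def] using \<open>r > 0\<close>
    by (intro DERIV_diff DERIV_divide DERIV_const deriv_A assms sq) auto
  have A': "A r * (P r + y r) / ((1 - y r) * r) = 2 * A r * (1 - G r) / r"
    using \<open>r > 0\<close> \<open>1 - y r > 0\<close> by (simp add: G_eq[OF assms] field_simps)
  show ?thesis
    by (rule DERIV_cong[OF d\<beta>], unfold A')
      (use \<open>r > 0\<close> in \<open>simp add: \<beta>_def field_simps power2_eq_square\<close>)
qed

text \<open>This is the Tolman-Oppenheimer-Volkoff equation for trace-free matter (density = radial
  + 2 * tangential pressure), here obtained from the explicit formula for \<open>P\<close>.\<close>

lemma deriv_P:
  assumes "r \<in> {1..R}"
  shows "(P has_real_derivative ((P r + D r) * G r - 2 * P r) / r) (at r within {1..R})"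
proof -
  have pos: "r > 0" "1 - y r > 0" "A r > 0" using assms range_y[OF assms] A_pos[OF assms] by auto
  have "((\<lambda>r. (max 0 (\<beta> r)) ^ 3) has_real_derivative 3 * (max 0 (\<beta> r))\<^sup>2 * (2 * (1 - \<beta> r) * G r / r))
      (at r within {1..R})"
    using DERIV_chain2[OF DERIV_pos_part_power[of 3] deriv_\<beta>[OF assms]] by simp
  \<comment> \<open>Replacing \<open>1 - \<beta> r\<close> by \<open>1 - B r\<close> is harmless:
    where they differ, the factor \<open>(B r)\<^sup>2\<close> vanishes.\<close>
  then have B3: "((\<lambda>r. B r ^ 3) has_real_derivative 3 * (B r)\<^sup>2 * (2 * (1 - B r) * G r / r))
      (at r within {1..R})"
    by (auto simp: B_def max_def)
  have dA: "(A has_real_derivative A r * (2 * (1 - G r)) / r) (at r within {1..R})"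
    by (rule DERIV_cong[OF deriv_A[OF assms]]) (use pos in \<open>simp add: G_eq[OF assms] field_simps\<close>)
  have "(P has_real_derivative
      (K * (3 * (B r)\<^sup>2 * (2 * (1 - B r) * G r / r)) * A r - K * B r ^ 3 * (A r * (2 * (1 - G r)) / r)) / (A r * A r))
      (at r within {1..R})"
    unfolding P_def[abs_def] using pos by (intro DERIV_divide DERIV_cmult B3 dA) auto
  moreover have "(K * (3 * (B r)\<^sup>2 * (2 * (1 - B r) * G r / r)) * A r - K * B r ^ 3 * (A r * (2 * (1 - G r)) / r)) / (A r * A r)
      = ((P r + D r) * G r - 2 * P r) / r"
    unfolding P_def D_def using pos by (simp add: field_simps power2_eq_square power3_eq_cube)
  ultimately show ?thesis by (rule DERIV_cong)
qed

text \<open>The equation for \<^term>\<open>Q\<close> does not involve \<^term>\<open>D\<close>; in the limit of infinitely thin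
  shells \<^term>\<open>Q\<close> is conserved, and \<open>Q = 4\<close>, \<open>P = 0\<close> give \<open>u = 1/3\<close>, i.e. \<open>y = 8/9\<close>.\<close>
lemma deriv_Q:
  assumes "r \<in> {1..R}"
  shows "(Q has_real_derivative
    - (12 * (1 - u r)\<^sup>2 + (Q r - 4) * (Q r + 4 - 6 * u r)) / (2 * u r * r)) (at r within {1..R})"
proof -
  have pos: "r > 0" "u r > 0" using assms u_bounds[OF assms] by auto
  let ?P' = "((P r + D r) * G r - 2 * P r) / r"
  have dQ: "(Q has_real_derivative
     ((?P' - 3 * ((D r - y r) / r)) * u r - (P r + 4 - 3 * y r) * ((y r - D r) / (2 * u r * r))) / (u r * u r))
     (at r within {1..R})"
    unfolding Q_def[abs_def] using pos
    by (intro DERIV_divide deriv_u assms)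
      (auto intro!: derivative_eq_intros deriv_P[OF assms] deriv_y[OF assms])
  \<comment> \<open>After substitution the coefficient of \<open>D r\<close> is a multiple of
    \<open>G r * u r - 3 * u r + Q r / 2\<close>, which is zero by the definition of
    \<open>G\<close>.\<close>
  have Qu: "P r + 4 - 3 * y r = Q r * u r" using pos by (simp add: Q_def)
  show ?thesis
    by (rule DERIV_cong[OF dQ], unfold Qu, unfold G_def P_eq[OF assms] y_eq[OF assms])
      (use pos in \<open>simp add: field_simps power2_eq_square\<close>)
qed

lemma Q_1: "Q 1 = 4"
  by (simp add: Q_def P_def B_def \<beta>_def u_def init)

text \<open>Where \<open>Q >= 4\<close>, both terms of the bracket in \<open>deriv_Q\<close> are
  nonnegative because \<open>u <= 1\<close>, so the initial value 4 is a barrier.\<close>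

lemma Q_le_4: 
  assumes "r \<in> {1..R}"
  shows "Q r \<le> 4"
proof (rule barrier[OF deriv_Q _ _ assms])
  fix t assume t: "t \<in> {1..R}" "4 \<le> Q t"
  have "0 \<le> 12 * (1 - u t)\<^sup>2 + (Q t - 4) * (Q t + 4 - 6 * u t)"
    using t u_bounds[OF t(1)] by (intro add_nonneg_nonneg mult_nonneg_nonneg) auto
  then show "- (12 * (1 - u t)\<^sup>2 + (Q t - 4) * (Q t + 4 - 6 * u t)) / (2 * u t * t) \<le> 0"
    unfolding minus_divide_left[symmetric] neg_le_0_iff_le
    by (rule divide_nonneg_nonneg) (use t u_bounds(1)[OF t(1)] in auto)
qed (simp_all add: Q_1)

text \<open>\<open>Q <= 4\<close> turns \<open>P = Q u - 1 - 3 u^2\<close> into a quadratic bound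
  that factors. Its maximum 1/3 at \<open>u = 2/3\<close> bounds the pressure, and its negativity
  for \<open>u < 1/3\<close> yields the Buchdahl bound.\<close>

lemma P_le:
  assumes "r \<in> {1..R}"
  shows "P r \<le> (1 - u r) * (3 * u r - 1)"
proof -
  have "Q r * u r \<le> 4 * u r"
    using Q_le_4[OF assms] u_bounds[OF assms] by (intro mult_right_mono) auto
  then show ?thesis using P_eq[OF assms] by (simp add: algebra_simps power2_eq_square)
qed

lemma P_le_third:
  assumes "r \<in> {1..R}"
  shows "P r \<le> 1/3"
proof -
  have "1/3 - (1 - u r) * (3 * u r - 1) = 3 * (u r - 2/3)\<^sup>2"
    by (simp add: algebra_simps power2_eq_square)
  then show ?thesis using P_le[OF assms] zero_le_power2[of "u r - 2/3"] by linarith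
qed

lemma u_ge:
  assumes "r \<in> {1..R}"
  shows "1/3 \<le> u r"
proof (rule ccontr)
  assume "\<not> 1/3 \<le> u r"
  then have "(1 - u r) * (3 * u r - 1) < 0" by (intro mult_pos_neg) auto
  then show False using P_le[OF assms] P_nonneg[OF assms] by linarith
qed

lemma y_le:
  assumes "r \<in> {1..R}"
  shows "y r \<le> 8/9"
  using power_mono[OF u_ge[OF assms], of 2] y_eq[OF assms] by (simp add: power2_eq_square)

text \<open>From \<open>P >= 0\<close> one has \<open>Q u >= 1 + 3 u^2 >= 3 u\<close>. This keeps
  \<open>Q + 4 - 6 u\<close> positive in \<open>Q_ge\<close>.\<close>

lemma Q_ge_3:
  assumes "r \<in> {1..R}"
  shows "3 \<le> Q r"
proof -
  have "P r + 1 + 3 * (u r)\<^sup>2 - 3 * u r = P r + 3 * (u r - 1/2)\<^sup>2 + 1/4"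
    by (simp add: algebra_simps power2_eq_square)
  then have "3 * u r \<le> Q r * u r"
    using P_eq[OF assms] P_nonneg[OF assms] zero_le_power2[of "u r - 1/2"] by linarith
  then show ?thesis using u_bounds[OF assms] by simp
qed

lemma Q_ge:
  assumes "r \<in> {1..R}"
  shows "4 - 8 * (r - 1) \<le> Q r"
proof -
  have "-8 * (r - 1) \<le> Q r - Q 1"
  proof (rule increment_ge[OF deriv_Q])
    fix t assume "1 < t" "t < r"
    then have t: "t \<in> {1..R}" using assms by auto
    note b = u_bounds[OF t] u_ge[OF t] Q_ge_3[OF t] Q_le_4[OF t]
    have "(Q t - 4) * (Q t + 4 - 6 * u t) \<le> 0"
      using b by (intro mult_nonpos_nonneg) auto
    \<comment> \<open>The product expresses \<open>12 (1 - u)^2 <= 16 u\<close>, valid for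
      \<open>u\<close> between 1/3 and 3, and is the source of the rate 8.\<close>
    moreover have "(3 * u t - 1) * (u t - 3) \<le> 0"
      using b by (intro mult_nonneg_nonpos) auto
    then have "12 * (1 - u t)\<^sup>2 \<le> 16 * u t" by (simp add: algebra_simps power2_eq_square)
    moreover have "16 * u t \<le> 16 * u t * t" using b \<open>1 < t\<close> by simp
    ultimately have "12 * (1 - u t)\<^sup>2 + (Q t - 4) * (Q t + 4 - 6 * u t) \<le> 8 * (2 * u t * t)"
      by linarith
    then have "(12 * (1 - u t)\<^sup>2 + (Q t - 4) * (Q t + 4 - 6 * u t)) / (2 * u t * t) \<le> 8"
      using b \<open>1 < t\<close> by (subst pos_divide_le_eq) auto
    then show "-8 \<le> - (12 * (1 - u t)\<^sup>2 + (Q t - 4) * (Q t + 4 - 6 * u t)) / (2 * u t * t)"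
      unfolding minus_divide_left[symmetric] by linarith
  qed (use assms in auto)
  then show ?thesis by (simp add: Q_1)
qed

text \<open>Improves the assumed range of \<open>A\<close>, as the continuation argument requires:
  the slope is at most \<open>2 * (1/3 + 8/9) * 9 = 22\<close> and the interval has length at most
  1/100.\<close>

lemma A_bounds:
  assumes "r \<in> {1..R}"
  shows "1 \<le> A r" "A r \<le> 3/2"
proof -
  have b: "0 \<le> A t * (P t + y t) / ((1 - y t) * t) \<and> A t * (P t + y t) / ((1 - y t) * t) \<le> 22"
    if "t \<in> {1..R}" for t
  proof
    note b = P_nonneg[OF that] P_le_third[OF that] y_nonneg[OF that] y_le[OF that] range_A[OF that]
    show "0 \<le> A t * (P t + y t) / ((1 - y t) * t)"
      using b that by (intro divide_nonneg_nonneg mult_nonneg_nonneg) auto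
    have "1/9 * 1 \<le> (1 - y t) * t"
      using b that by (intro mult_mono) auto
    then have "A t * (P t + y t) / ((1 - y t) * t) \<le> 2 * (1/3 + 8/9) / (1/9)"
      using b by (intro frac_le mult_mono add_mono) auto
    then show "A t * (P t + y t) / ((1 - y t) * t) \<le> 22" by simp
  qed
  have "0 * (r - 1) \<le> A r - A 1"
    using b assms by (intro increment_ge[OF deriv_A]) auto
  then show "1 \<le> A r" by (simp add: init)
  have "A r - A 1 \<le> 22 * (r - 1)"
    using b assms by (intro increment_le[OF deriv_A]) auto
  then show "A r \<le> 3/2" using assms R by (simp add: init)
qed

text \<open>Equality would force \<open>u = 1/3\<close> and \<open>Q = 4\<close>, the largest value
  \<open>Q\<close> can take; but there \<open>Q' = -8 / r\<close>, so \<open>Q\<close> would have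
  exceeded 4 just before.\<close>

lemma y_less:
  assumes "r \<in> {1..R}"
  shows "y r < 8/9"
proof (rule ccontr)
  assume "\<not> y r < 8/9"
  then have "y r = 8/9" using y_le[OF assms] by simp
  then have "1 - y r = (1/3)\<^sup>2" by (simp add: power2_eq_square)
  then have u: "u r = 1/3" unfolding u_def by simp
  have "r \<noteq> 1" using \<open>y r = 8/9\<close> init by auto
  then have r: "1 < r" using assms by auto
  have "Q r = 4"
    using P_eq[OF assms] P_nonneg[OF assms] Q_le_4[OF assms] u by (simp add: power2_eq_square)
  have "(Q has_real_derivative - 8 / r) (at r within {1..R})"
    using deriv_Q[OF assms] r by (simp add: u \<open>Q r = 4\<close> power2_eq_square)
  then obtain d where "d > 0" "\<And>h. 0 < h \<Longrightarrow> r - h \<in> {1..R} \<Longrightarrow> h < d \<Longrightarrow> Q r < Q (r - h)"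
    using has_real_derivative_neg_dec_left[of Q "- 8 / r" r "{1..R}"] r by auto
  moreover define h where "h = min (d / 2) (r - 1)"
  ultimately have "Q r < Q (r - h)" and h: "r - h \<in> {1..R}"
    using r assms by auto
  then show False using Q_le_4[OF h] \<open>Q r = 4\<close> by simp
qed

text \<open>Density can only lower \<open>u\<close>, so the rate is at most
  \<open>y / (2 u r) <= (8/9) / (2/3)\<close>. The estimate is one-sided, since a huge
  \<open>D\<close> makes \<open>u\<close> drop steeply.\<close>

lemma u_increase:
  assumes "1 \<le> s" "s \<le> t" "t \<le> R"
  shows "u t - u s \<le> 4/3 * (t - s)"
proof (rule increment_le[OF deriv_u])
  fix r assume "s < r" "r < t"
  then have r: "r \<in> {1..R}" using assms by auto
  have "1/3 * 1 \<le> u r * r" using u_ge[OF r] r by (intro mult_mono) auto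
  then have "y r - D r \<le> 4/3 * (2 * (u r * r))"
    using D_nonneg[OF r] y_le[OF r] by linarith
  then show "(y r - D r) / (2 * u r * r) \<le> 4/3"
    using u_bounds(1)[OF r] r by (simp add: pos_divide_le_eq mult.assoc)
qed (use assms in auto)

lemma continuous_on_u: "continuous_on {1..R} u"
  using deriv_u by (rule DERIV_continuous_on)

lemma continuous_on_\<beta>: "continuous_on {1..R} \<beta>"
  using deriv_\<beta> by (rule DERIV_continuous_on)

end

section \<open>Crossing a thin shell of large amplitude\<close>

locale massive_shell = shell +
  assumes K_eq: "K = 10 ^ 12" and R_eq: "R = 101/100"
begin

text \<open>\<open>K = 10 ^ 12\<close> is chosen for this: bounded pressure gives
  \<open>K * B^3 <= 2/3\<close>, hence \<open>B <= 1/10000\<close>.\<close>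

lemma B_small:
  assumes "r \<in> {1..R}"
  shows "B r \<le> 1/10000"
proof -
  have "K * B r ^ 3 = P r * A r" using A_pos[OF assms] by (simp add: P_def)
  also have "\<dots> \<le> 1/3 * 2"
    using P_le_third[OF assms] range_A[OF assms] P_nonneg[OF assms] by (intro mult_mono) auto
  finally have "B r ^ 3 \<le> (1/10000) ^ 3" by (simp add: K_eq power_divide)
  then show ?thesis using B_bounds(1)[OF assms] by (subst (asm) power_mono_iff) auto
qed

lemma \<beta>_small: "r \<in> {1..R} \<Longrightarrow> \<beta> r \<le> 1/10000"
  using B_small[of r] by (simp add: B_def)

lemma Q_ge': "r \<in> {1..R} \<Longrightarrow> 392/100 \<le> Q r"
  using Q_ge[of r] by (simp add: R_eq)

text \<open>While \<open>u\<close> is near \<open>1\<close>, the growth rate of \<^term>\<open>\<beta>\<close> is bounded below and \<^term>\<open>\<beta>\<close> would exceed its bound.\<close>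
lemma leave_vacuum: "u (10002/10000) < 9/10"
proof (rule ccontr)
  assume "\<not> ?thesis"
  then have u: "9/10 \<le> u (10002/10000)" by simp
  \<comment> \<open>Growth at rate 1 over the length 2/10000 would give \<open>\<beta>\<close> twice
    its permitted maximum 1/10000.\<close>
  have "1 * (10002/10000 - 1) \<le> \<beta> (10002/10000) - \<beta> 1"
  proof (rule increment_ge[OF deriv_\<beta>])
    fix t :: real assume t: "1 < t" "t < 10002/10000"
    then have t': "t \<in> {1..R}" by (simp add: R_eq)
    \<comment> \<open>Used backwards: \<open>u\<close> gains less than 1/1000 up to the right
      endpoint, so it was already close to 9/10.\<close>
    have "u (10002/10000) - u t \<le> 4/3 * (10002/10000 - t)"
      using t by (intro u_increase) (auto simp: R_eq)
    then have "89/100 \<le> u t" using u t by simp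
    then have G: "7/10 \<le> G t" using Q_le_4[OF t'] by (simp add: G_def pos_le_divide_eq)
    have "2 * (9999/10000) * (7/10) / (10002/10000) \<le> 2 * (1 - \<beta> t) * G t / t"
      using G t \<beta>_small[OF t'] by (intro frac_le mult_mono) auto
    then show "1 \<le> 2 * (1 - \<beta> t) * G t / t" by simp
  qed (auto simp: R_eq)
  moreover have "\<beta> 1 = 0" by (simp add: \<beta>_def init)
  ultimately show False using \<beta>_small[of "10002/10000"] by (simp add: R_eq)
qed

text \<open>For intermediate \<open>u\<close> the pressure is bounded below, so smallness of \<^term>\<open>\<beta>\<close> forces
  a huge density.\<close>
lemma reach_compact: "\<exists>r\<in>{1..1008/1000}. u r \<le> 45/100"
proof (rule ccontr)
  assume "\<not> ?thesis"
  then have u: "45/100 \<le> u r" if "r \<in> {1..1008/1000}" for r using that by force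
  \<comment> \<open>Over the length 78/10000, slope 1000 would raise \<open>y\<close> by more than
    7, although \<open>y\<close> stays in [0, 8/9].\<close>
  have "1000 * (1008/1000 - 10002/10000) \<le> y (1008/1000) - y (10002/10000)"
  proof (rule increment_ge[OF deriv_y])
    fix t :: real assume t: "10002/10000 < t" "t < 1008/1000"
    then have t': "t \<in> {1..R}" by (simp add: R_eq)
    have "u t - u (10002/10000) \<le> 4/3 * (t - 10002/10000)"
      using t by (intro u_increase) (auto simp: R_eq)
    then have "u t \<le> 92/100" using leave_vacuum t by simp
    \<comment> \<open>Chord estimate: replacing \<open>u^2\<close> by its linear upper bound on
      [45/100, 92/100] makes the lower bound for \<open>P\<close> linear in
      \<open>u\<close>.\<close>
    then have "0 \<le> (u t - 45/100) * (92/100 - u t)"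
      using u[of t] t by (intro mult_nonneg_nonneg) auto
    moreover have "392/100 * u t \<le> Q t * u t"
      using Q_ge'[OF t'] u_bounds[OF t'] by (intro mult_right_mono) auto
    moreover have "(u t - 45/100) * (92/100 - u t) = 137/100 * u t - 414/1000 - (u t)\<^sup>2"
      by (simp add: algebra_simps power2_eq_square)
    ultimately have P: "6/100 \<le> P t"
      using P_eq[OF t'] \<open>u t \<le> 92/100\<close> by linarith
    have "B t \<noteq> 0" using P by (auto simp: P_def)
    then have B: "0 < B t" using B_bounds[OF t'] by simp
    have "D t = P t * (6 - 5 * B t) / B t"
      using B by (simp add: D_def P_def power2_eq_square power3_eq_cube)
    moreover have "6/100 * 5 / (1/10000) \<le> P t * (6 - 5 * B t) / B t"
      using P B B_small[OF t'] by (intro frac_le mult_mono) auto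
    ultimately have "3000 \<le> D t" by simp
    then have "1000 * t \<le> D t - y t" using y_le[OF t'] t by simp
    then show "1000 \<le> (D t - y t) / t" using t by (simp add: pos_le_divide_eq)
  qed (auto simp: R_eq)
  then show False using y_le[of "1008/1000"] y_nonneg[of "10002/10000"] by (simp add: R_eq)
qed

text \<open>From the radius \<open>d\<close> with \<open>u = 45/100\<close> on,
  \<open>G <= -1\<close> and \<open>\<beta>\<close> falls at unit rate from at most 1/10000, so it
  vanishes before \<open>R\<close>; there \<open>P = 0\<close> confines \<open>u\<close>.\<close>

lemma shell_edge:
  obtains r1 where "1 < r1" "r1 \<le> R" "\<beta> r1 = 0" "4/5 < y r1"
proof -
  obtain e where e: "1 \<le> e" "e \<le> 1008/1000" "u e \<le> 45/100" using reach_compact by auto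
  have "u 1 = 1" by (simp add: u_def init)
  \<comment> \<open>Continuity provides the exact value 45/100, at which \<open>P\<close> is
    positive, so matter is still present at \<open>d\<close>.\<close>
  then obtain d where d: "1 \<le> d" "d \<le> e" "u d = 45/100"
    using IVT2'[of u e "45/100" 1] e continuous_on_subset[OF continuous_on_u, of "{1..e}"]
    by (auto simp: R_eq)
  then have d': "d \<in> {1..R}" using e by (simp add: R_eq)
  have "P d > 0" using P_eq[OF d'] Q_ge'[OF d'] d by (simp add: power2_eq_square)
  then have "B d \<noteq> 0" by (auto simp: P_def)
  then have \<beta>d: "\<beta> d > 0" by (simp add: B_def max_def split: if_splits)
  \<comment> \<open>On the remaining interval \<open>u\<close> can regain at most
    \<open>4/3 * 1/100\<close>.\<close>
  have u_small: "u t \<le> 464/1000" if "d \<le> t" "t \<le> R" for t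
    using u_increase[of d t] d that by (simp add: R_eq)
  have "\<beta> R - \<beta> d \<le> -1 * (R - d)"
  proof (rule increment_le[OF deriv_\<beta>])
    fix t assume t: "d < t" "t < R"
    then have t': "t \<in> {1..R}" using d by auto
    have "G t \<le> - 1"
      using u_small[of t] t Q_ge'[OF t'] u_bounds[OF t'] by (simp add: G_def pos_divide_le_eq)
    then have "2 * (9999/10000) * 1 \<le> 2 * (1 - \<beta> t) * - G t"
      using \<beta>_small[OF t'] by (intro mult_mono) auto
    then have "2 * (1 - \<beta> t) * G t \<le> -1 * t" using t' by (simp add: R_eq)
    then show "2 * (1 - \<beta> t) * G t / t \<le> -1" using t' by (simp add: pos_divide_le_eq)
  qed (use d d' in auto)
  then have "\<beta> R \<le> 0" using \<beta>_small[OF d'] d e by (simp add: R_eq)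
  then obtain r1 where r1: "d \<le> r1" "r1 \<le> R" "\<beta> r1 = 0"
    using IVT2'[of \<beta> R 0 d] \<beta>d d' continuous_on_subset[OF continuous_on_\<beta>, of "{d..R}"] by auto
  then have r1': "r1 \<in> {1..R}" using d by auto
  have "P r1 = 0" using r1 by (simp add: P_def B_def)
  \<comment> \<open>With \<open>P = 0\<close> and \<open>Q >= 392/100\<close> one has
    \<open>3 u^2 - 392/100 u + 1 >= 0\<close>, which fails throughout [44/100, 464/1000]; a chord
    estimate again makes this linear. The bound 44/100 suffices because
    \<open>1 - (44/100)^2 > 4/5\<close>.\<close>
  have "u r1 < 44/100"
  proof (rule ccontr)
    assume "\<not> u r1 < 44/100"
    then have "0 \<le> (u r1 - 44/100) * (464/1000 - u r1)"
      using u_small[of r1] r1 by (intro mult_nonneg_nonneg) auto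
    moreover have "392/100 * u r1 \<le> Q r1 * u r1"
      using Q_ge'[OF r1'] u_bounds[OF r1'] by (intro mult_right_mono) auto
    moreover have "(u r1 - 44/100) * (464/1000 - u r1) = 904/1000 * u r1 - 20416/100000 - (u r1)\<^sup>2"
      by (simp add: field_simps power2_eq_square)
    ultimately show False
      using P_eq[OF r1'] \<open>P r1 = 0\<close> u_small[of r1] r1 \<open>\<not> u r1 < 44/100\<close> by linarith
  qed
  then have "(u r1)\<^sup>2 < (44/100)\<^sup>2" using u_bounds[OF r1'] by (intro power_strict_mono) auto
  then have "4/5 < y r1" using y_eq[OF r1'] by (simp add: power2_eq_square)
  moreover have "r1 \<noteq> 1" using \<open>4/5 < y r1\<close> init by auto
  ultimately show thesis using that[of r1] r1 d by auto
qed

end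

section \<open>Existence of the shell by truncation and continuation\<close>

locale photon_shell =
  fixes A y :: "real \<Rightarrow> real" and r1 K :: real
  assumes r1: "1 < r1" and init: "A 1 = 1" "y 1 = 0" and final: "A r1 = r1\<^sup>2" "4/5 < y r1"
    and bounds: "\<And>r. r \<in> {1..r1} \<Longrightarrow> 1 \<le> A r \<and> 0 \<le> y r \<and> y r < 8/9"
    and ode_A: "\<And>r. r \<in> {1..r1} \<Longrightarrow>
      (A has_real_derivative (K * (max 0 (1 - A r / r\<^sup>2)) ^ 3 + A r * y r) / ((1 - y r) * r))
        (at r within {1..r1})"
    and ode_y: "\<And>r. r \<in> {1..r1} \<Longrightarrow>
      (y has_real_derivative
        (K * (max 0 (1 - A r / r\<^sup>2))\<^sup>2 * (6 - 5 * max 0 (1 - A r / r\<^sup>2)) / A r - y r) / r)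
        (at r within {1..r1})"

text \<open>The right-hand side is truncated to a bounded region; the a priori bounds show that the
  truncation is never active.\<close>

lemma shell_exists:
  fixes K :: real
  assumes K: "K = 10 ^ 12"
  obtains A y r1 where "photon_shell A y r1 K"
proof -
  define R :: real where "R = 101/100"
  define cr where "cr = (\<lambda>z :: real \<times> real \<times> real. max 1 (min R (fst z)))"
  define cA where "cA = (\<lambda>z :: real \<times> real \<times> real. max (1/2) (min 2 (fst (snd z))))"
  define cy where "cy = (\<lambda>z :: real \<times> real \<times> real. max (-1) (min (9/10) (snd (snd z))))"
  have fst_snd: "\<bar>fst z - fst z'\<bar> \<le> dist z z'" "\<bar>fst (snd z) - fst (snd z')\<bar> \<le> dist z z'"
    "\<bar>snd (snd z) - snd (snd z')\<bar> \<le> dist z z'" for z z' :: "real \<times> real \<times> real"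
    using dist_fst_le[of z z'] dist_snd_le[of z z'] dist_fst_le[of "snd z" "snd z'"] dist_snd_le[of "snd z" "snd z'"]
    by (auto simp: dist_real_def)
  have bl: "bounded_lipschitz cr" "bounded_lipschitz cA" "bounded_lipschitz cy"
    unfolding cr_def cA_def cy_def by (intro bounded_lipschitz_clamp fst_snd)+
  have inv: "bounded_lipschitz (\<lambda>z. inverse (cr z))" "bounded_lipschitz (\<lambda>z. inverse (cA z))"
      "bounded_lipschitz (\<lambda>z. inverse (1 - cy z))"
  proof -
    show "bounded_lipschitz (\<lambda>z. inverse (cr z))"
      by (rule bounded_lipschitz_inverse[OF bl(1), of 1]) (auto simp: cr_def)
    show "bounded_lipschitz (\<lambda>z. inverse (cA z))"
      by (rule bounded_lipschitz_inverse[OF bl(2), of "1/2"]) (auto simp: cA_def)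
    show "bounded_lipschitz (\<lambda>z. inverse (1 - cy z))"
      by (rule bounded_lipschitz_inverse[OF bounded_lipschitz_diff[OF bounded_lipschitz_const bl(3)], of "1/10"])
        (auto simp: cy_def)
  qed
  define cB where "cB = (\<lambda>z. max 0 (1 - cA z * (inverse (cr z))\<^sup>2))"
  have blB: "bounded_lipschitz cB"
    unfolding cB_def by (intro bounded_lipschitz_intros bl inv)
  define F where "F = (\<lambda>z. (K * cB z ^ 3 + cA z * cy z) * (inverse (1 - cy z) * inverse (cr z)))"
  define H where "H = (\<lambda>z. (K * (cB z)\<^sup>2 * (6 - 5 * cB z) * inverse (cA z) - cy z) * inverse (cr z))"
  have "bounded_lipschitz F" "bounded_lipschitz H"
    unfolding F_def H_def by (intro bounded_lipschitz_intros bl inv blB)+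
  then obtain A y where init: "A 1 = 1" "y 1 = 0"
    and dA: "\<And>t. t \<in> {1..R} \<Longrightarrow> (A has_real_derivative F (t, A t, y t)) (at t within {1..R})"
    and dy: "\<And>t. t \<in> {1..R} \<Longrightarrow> (y has_real_derivative H (t, A t, y t)) (at t within {1..R})"
    by (rule bounded_lipschitz_ode[of F H 1 R 1 0]) (auto simp: R_def)
  have F_eq: "F (r, A r, y r) = (K * (max 0 (1 - A r / r\<^sup>2)) ^ 3 + A r * y r) / ((1 - y r) * r)"
    and H_eq: "H (r, A r, y r) =
        (K * (max 0 (1 - A r / r\<^sup>2))\<^sup>2 * (6 - 5 * max 0 (1 - A r / r\<^sup>2)) / A r - y r) / r"
    if "r \<in> {1..R}" "1/2 \<le> A r \<and> A r \<le> 2" "-1 \<le> y r \<and> y r \<le> 9/10" for r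
  proof -
    have "cr (r, A r, y r) = r" "cA (r, A r, y r) = A r" "cy (r, A r, y r) = y r"
      using that by (auto simp: cr_def cA_def cy_def)
    then show "F (r, A r, y r) = (K * (max 0 (1 - A r / r\<^sup>2)) ^ 3 + A r * y r) / ((1 - y r) * r)"
      "H (r, A r, y r) =
        (K * (max 0 (1 - A r / r\<^sup>2))\<^sup>2 * (6 - 5 * max 0 (1 - A r / r\<^sup>2)) / A r - y r) / r"
      by (simp_all add: F_def H_def cB_def divide_inverse power_inverse)
  qed
  have shell: "shell A y K r"
    if r: "r \<in> {1..R}" and rng: "\<And>s. s \<in> {1..r} \<Longrightarrow> (1/2 \<le> A s \<and> A s \<le> 2) \<and> (-1 \<le> y s \<and> y s \<le> 9/10)" for r
  proof
    fix s assume s: "s \<in> {1..r}"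
    then have s': "s \<in> {1..R}" and sub: "{1..r} \<subseteq> {1..R}" using r by auto
    note rs = rng[OF s, THEN conjunct1] rng[OF s, THEN conjunct2]
    show "(A has_real_derivative (K * (max 0 (1 - A s / s\<^sup>2)) ^ 3 + A s * y s) / ((1 - y s) * s))
        (at s within {1..r})"
      using has_field_derivative_subset[OF dA[OF s'] sub] unfolding F_eq[OF s' rs] .
    show "(y has_real_derivative
        (K * (max 0 (1 - A s / s\<^sup>2))\<^sup>2 * (6 - 5 * max 0 (1 - A s / s\<^sup>2)) / A s - y s) / s)
        (at s within {1..r})"
      using has_field_derivative_subset[OF dy[OF s'] sub] unfolding H_eq[OF s' rs] .
    show "1/2 \<le> A s \<and> A s \<le> 2" "-1 \<le> y s \<and> y s \<le> 9/10" using rs by auto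
  next
    show "0 \<le> K" by (simp add: K)
    show "1 \<le> r" "r \<le> 101/100" using r by (simp_all add: R_def)
  qed (rule init)+
  \<comment> \<open>Bounds pass from \<open>U\<close> to the closed set \<open>C\<close> by taking
    limits, and on \<open>C\<close> the truncated and the original equations agree; the shell
    estimates then lead strictly back into \<open>U\<close>.\<close>
  define U :: "(real \<times> real) set" where "U = {1/2<..<2} \<times> {-1<..<9/10}"
  define C :: "(real \<times> real) set" where "C = {1/2..2} \<times> {-1..9/10}"
  have cont: "continuous_on {1..R} (\<lambda>r. (A r, y r))"
    using DERIV_continuous_on[OF dA] DERIV_continuous_on[OF dy] by (intro continuous_intros) auto
  have inU: "(A r, y r) \<in> U" if "r \<in> {1..R}" for r
  proof (rule continuous_bootstrap[OF cont _ _ that])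
    show "open U" by (simp add: U_def open_Times)
    fix r assume r: "r \<in> {1..R}" and below: "\<And>s. 1 \<le> s \<Longrightarrow> s < r \<Longrightarrow> (A s, y s) \<in> U"
    have "(A s, y s) \<in> C" if s: "s \<in> {1..r}" for s
    \<comment> \<open>At \<open>r = 1\<close> the half-open interval is empty, so its closure misses
      the point and the initial values are used directly.\<close>
    proof (cases "r = 1")
      case True
      with s init show ?thesis by (auto simp: C_def)
    next
      case False
      then have cl: "closure {1..<r} = {1..r}" using r by simp
      have "(\<lambda>r. (A r, y r)) ` closure {1..<r} \<subseteq> C"
      proof (rule image_closure_subset)
        show "continuous_on (closure {1..<r}) (\<lambda>r. (A r, y r))"
          unfolding cl using r by (intro continuous_on_subset[OF cont]) auto
        show "closed C" by (simp add: C_def closed_Times)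
        show "(\<lambda>r. (A r, y r)) ` {1..<r} \<subseteq> C"
          using below by (force simp: U_def C_def)
      qed
      then show ?thesis using s unfolding cl by auto
    qed
    then have "shell A y K r" by (intro shell r) (auto simp: C_def)
    then interpret s: shell A y K r .
    have r': "r \<in> {1..r}" using r by simp
    show "(A r, y r) \<in> U"
      using s.A_bounds[OF r'] s.y_nonneg[OF r'] s.y_less[OF r'] by (simp add: U_def)
  qed
  have "shell A y K R"
  proof (rule shell)
    show "(1/2 \<le> A s \<and> A s \<le> 2) \<and> (-1 \<le> y s \<and> y s \<le> 9/10)" if "s \<in> {1..R}" for s
      using inU[OF that] by (simp add: U_def)
  qed (simp add: R_def)
  then interpret massive_shell A y K R
    by (simp add: massive_shell_def massive_shell_axioms_def K R_def)
  obtain r1 where r1: "1 < r1" "r1 \<le> R" "\<beta> r1 = 0" "4/5 < y r1" by (rule shell_edge)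
  have sub: "{1..r1} \<subseteq> {1..R}" using r1 by auto
  have "photon_shell A y r1 K"
  proof
    show "A r1 = r1\<^sup>2" using r1 by (simp add: \<beta>_def)
    fix r assume "r \<in> {1..r1}"
    then have r: "r \<in> {1..R}" using sub by blast
    show "1 \<le> A r \<and> 0 \<le> y r \<and> y r < 8/9"
      using A_bounds(1)[OF r] y_nonneg[OF r] y_less[OF r] by blast
    show "(A has_real_derivative (K * (max 0 (1 - A r / r\<^sup>2)) ^ 3 + A r * y r) / ((1 - y r) * r))
        (at r within {1..r1})"
      by (rule has_field_derivative_subset[OF ode_A[OF r] sub])
    show "(y has_real_derivative
        (K * (max 0 (1 - A r / r\<^sup>2))\<^sup>2 * (6 - 5 * max 0 (1 - A r / r\<^sup>2)) / A r - y r) / r)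
        (at r within {1..r1})"
      by (rule has_field_derivative_subset[OF ode_y[OF r] sub])
  qed (rule r1 init)+
  then show thesis by (rule that)
qed

section \<open>Momentum integrals\<close>

text \<open>The exponent 3/2 exceeds 1, so the function is differentiable at 0; its homogeneity
  supplies the factor \<open>b * sqrt b\<close> in \<open>emission_moment\<close>.\<close>

definition pos_part32 :: "real \<Rightarrow> real" where
  "pos_part32 t = max 0 t * sqrt (max 0 t)"

lemma DERIV_pos_part32: "(pos_part32 has_real_derivative 3/2 * sqrt (max 0 t)) (at t)"
  unfolding pos_part32_def[abs_def]
proof (rule DERIV_pos_part[of "\<lambda>t. t * sqrt t" "\<lambda>t. 3/2 * sqrt t"])
  have "((\<lambda>t::real. sqrt t) \<longlongrightarrow> 0) (at_right 0)"
    by (auto intro!: tendsto_eq_intros)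
  then show "((\<lambda>t::real. t * sqrt t / t) \<longlongrightarrow> 0) (at_right 0)"
    by (rule Lim_transform_eventually) (auto simp: eventually_at_topological intro!: exI[of _ UNIV])
  show "((\<lambda>t. t * sqrt t) has_real_derivative 3/2 * sqrt t) (at t)" if "0 < t" for t :: real
  proof -
    have "t / sqrt t = sqrt t" using that by (simp add: real_div_sqrt)
    then show ?thesis using that by (auto intro!: derivative_eq_intros simp: field_simps)
  qed
qed auto

lemma pos_part32_nonneg: "0 \<le> pos_part32 t"
  by (simp add: pos_part32_def)

lemma pos_part32_eq_0: "t \<le> 0 \<Longrightarrow> pos_part32 t = 0"
  by (simp add: pos_part32_def)

lemma pos_part32_mult: "0 \<le> c \<Longrightarrow> pos_part32 (c * t) = c * sqrt c * pos_part32 t"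
  by (cases "0 \<le> t") (auto simp: pos_part32_def real_sqrt_mult max_def mult_le_0_iff zero_le_mult_iff)

lemma continuous_on_pos_part32 [continuous_intros]:
  "continuous_on S f \<Longrightarrow> continuous_on S (\<lambda>x. pos_part32 (f x))"
  unfolding pos_part32_def by (intro continuous_intros)

text \<open>Convexity of the positive part to the power 5/2. In terms of the square roots
  \<open>a\<close> and \<open>b\<close> the difference is a polynomial with a double zero at
  \<open>b = a\<close> and a nonnegative cofactor.\<close>

lemma pos_part52_tangent:
  "y * pos_part32 y \<ge> x * pos_part32 x + 5/2 * pos_part32 x * (y - x)"
proof -
  define a b where "a = sqrt (max 0 x)" and "b = sqrt (max 0 y)"
  have ab: "a \<ge> 0" "b \<ge> 0" "a\<^sup>2 = max 0 x" "b\<^sup>2 = max 0 y" by (auto simp: a_def b_def)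
  have p: "pos_part32 x = a ^ 3" "pos_part32 y = b ^ 3"
    using ab by (auto simp: pos_part32_def power3_eq_cube power2_eq_square simp flip: a_def b_def)
  have y: "y * pos_part32 y = b ^ 5"
    using ab(4) by (cases "y \<ge> 0") (auto simp: p eval_nat_numeral max_def split: if_splits)
  have x: "x * pos_part32 x = a ^ 5"
    using ab(3) by (cases "x \<ge> 0") (auto simp: p eval_nat_numeral max_def split: if_splits)
  have "pos_part32 x * (y - x) \<le> a ^ 3 * (b\<^sup>2 - a\<^sup>2)"
  proof (cases "x \<ge> 0")
    case True
    then show ?thesis using ab unfolding p by (intro mult_left_mono) auto
  next
    case False
    then show ?thesis using ab by (simp add: p)
  qed
  moreover have "b ^ 5 - a ^ 5 - 5/2 * (a ^ 3 * (b\<^sup>2 - a\<^sup>2))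
      = (b - a)\<^sup>2 * (2 * b ^ 3 + 4 * a * b\<^sup>2 + 6 * a\<^sup>2 * b + 3 * a ^ 3) / 2"
    by (simp add: field_simps eval_nat_numeral)
  moreover have "0 \<le> (b - a)\<^sup>2 * (2 * b ^ 3 + 4 * a * b\<^sup>2 + 6 * a\<^sup>2 * b + 3 * a ^ 3) / 2"
    using ab by (intro divide_nonneg_nonneg mult_nonneg_nonneg add_nonneg_nonneg) auto
  ultimately show ?thesis unfolding x y by linarith
qed

section \<open>Linear substitutions in momentum space\<close>

lemma lborel_linear_image:
  fixes T :: "real^'n::{finite,wellorder} \<Rightarrow> real^'n::_"
  assumes T: "linear T" and det: "det (matrix T) \<noteq> 0"
  shows "lborel = density (distr lborel borel T) (\<lambda>_. ennreal \<bar>det (matrix T)\<bar>)"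
proof (rule lborel_eqI)
  have [measurable]: "T \<in> borel \<rightarrow>\<^sub>M borel"
    using T by (intro borel_measurable_continuous_onI linear_continuous_on) (simp add: linear_conv_bounded_linear)
  have inj: "inj T" using det det_nz_iff_inj[OF T] by simp
  then have surj: "surj T" using T linear_injective_imp_surjective by blast
  have bij: "bij T" using inj surj by (simp add: bij_def)
  fix l u :: "real^'n::_" assume le: "\<And>b. b \<in> Basis \<Longrightarrow> l \<bullet> b \<le> u \<bullet> b"
  let ?S = "T -` box l u"
  have inv: "linear (inv T)"
    using linear_injective_left_inverse[OF T inj] bij by (metis inj inv_unique_comp left_right_inverse_eq surj surj_iff T inj_linear_imp_inv_linear)
  have S: "?S \<in> lmeasurable"
    using measurable_linear_image[OF inv lmeasurable_box] by (simp add: bij_vimage_eq_inv_image[OF bij])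
  have S_borel: "?S \<in> sets borel" using measurable_sets[OF \<open>T \<in> borel \<rightarrow>\<^sub>M borel\<close>, of "box l u"] by simp
  have "emeasure (density (distr lborel borel T) (\<lambda>_. ennreal \<bar>det (matrix T)\<bar>)) (box l u)
      = ennreal \<bar>det (matrix T)\<bar> * emeasure lborel ?S"
    by (simp add: emeasure_density_const emeasure_distr)
  also have "emeasure lborel ?S = ennreal (measure lebesgue ?S)"
    using emeasure_eq_measure2[OF S] S_borel by simp
  also have "ennreal \<bar>det (matrix T)\<bar> * ennreal (measure lebesgue ?S) = ennreal (measure lebesgue (T ` ?S))"
    unfolding measure_linear_image[OF T S] by (simp add: ennreal_mult)
  \<comment> \<open>As \<open>T\<close> is onto, the box is the image of its preimage, so its volume
    is |det| times that of the preimage.\<close>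
  also have "T ` ?S = box l u" using surj by (simp add: surj_image_vimage_eq)
  also have "measure lebesgue (box l u) = (\<Prod>b\<in>Basis. (u - l) \<bullet> b)"
    using le by (simp add: measure_lborel_box)
  finally show "emeasure (density (distr lborel borel T) (\<lambda>_. ennreal \<bar>det (matrix T)\<bar>)) (box l u)
      = ennreal (\<Prod>b\<in>Basis. (u - l) \<bullet> b)" .
qed simp

lemma lborel_integral_linear:
  fixes T :: "real^'n::{finite,wellorder} \<Rightarrow> real^'n::_" and g :: "real^'n::_ \<Rightarrow> real"
  assumes T: "linear T" and det: "det (matrix T) \<noteq> 0" and g[measurable]: "g \<in> borel_measurable borel"
  shows "integral\<^sup>L lborel g = \<bar>det (matrix T)\<bar> * integral\<^sup>L lborel (\<lambda>v. g (T v))"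
proof -
  have [measurable]: "T \<in> borel \<rightarrow>\<^sub>M borel"
    using T by (intro borel_measurable_continuous_onI linear_continuous_on) (simp add: linear_conv_bounded_linear)
  have "integral\<^sup>L lborel g
      = integral\<^sup>L (density (distr lborel borel T) (\<lambda>_. ennreal \<bar>det (matrix T)\<bar>)) g"
    using lborel_linear_image[OF T det] by simp
  also have "\<dots> = \<bar>det (matrix T)\<bar> * integral\<^sup>L lborel (\<lambda>v. g (T v))"
    by (subst integral_density) (auto simp: integral_distr)
  finally show ?thesis .
qed

text \<open>The substitution stretches the first axis by \<open>a\<close> and the other two by
  \<open>b\<close>, with determinant \<open>a * b\<^sup>2\<close>.\<close>

lemma integral_axis_scaling:
  fixes G :: "real \<Rightarrow> real \<Rightarrow> real"
  assumes cont: "continuous_on UNIV (\<lambda>(n, c). G n c)" and ab: "0 < a" "0 < b"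
  shows "integral\<^sup>L lborel (\<lambda>v::real^3. G (v \<bullet> v) (v $ 1))
    = a * b\<^sup>2 * integral\<^sup>L lborel (\<lambda>v::real^3. G (a\<^sup>2 * (v $ 1)\<^sup>2 + b\<^sup>2 * (v \<bullet> v - (v $ 1)\<^sup>2)) (a * v $ 1))"
proof -
  define d :: "3 \<Rightarrow> real" where "d = (\<lambda>i. if i = 1 then a else b)"
  define T :: "real^3 \<Rightarrow> real^3" where "T = (\<lambda>v. \<chi> i. d i * v $ i)"
  have T: "linear T" by (intro linearI) (auto simp: T_def vec_eq_iff algebra_simps)
  have "matrix T = (\<chi> i j. if i = j then d i else 0)"
    by (auto simp: matrix_def T_def vec_eq_iff axis_def)
  then have "det (matrix T) = (\<Prod>i\<in>UNIV. d i)"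
    by (simp add: det_diagonal)
  also have "\<dots> = a * b\<^sup>2"
    unfolding UNIV_3 by (simp add: d_def power2_eq_square)
  finally have det: "det (matrix T) = a * b\<^sup>2" .
  have "continuous_on UNIV (\<lambda>v::real^3. G (v \<bullet> v) (v $ 1))"
    using continuous_on_compose2[OF cont, of UNIV "\<lambda>v::real^3. (v \<bullet> v, v $ 1)"]
    by (simp add: continuous_intros)
  then have "integral\<^sup>L lborel (\<lambda>v::real^3. G (v \<bullet> v) (v $ 1))
    = a * b\<^sup>2 * integral\<^sup>L lborel (\<lambda>v. G (T v \<bullet> T v) (T v $ 1))"
    using ab by (subst lborel_integral_linear[OF T]) (auto simp: det intro: borel_measurable_continuous_onI)
  moreover have "T v \<bullet> T v = a\<^sup>2 * (v $ 1)\<^sup>2 + b\<^sup>2 * (v \<bullet> v - (v $ 1)\<^sup>2)" "T v $ 1 = a * v $ 1" for v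
    by (auto simp: T_def inner_vec_def sum_3 d_def power2_eq_square algebra_simps)
  ultimately show ?thesis by simp
qed

text \<open>A rotation taking the first axis to the direction of \<open>x\<close> preserves norms
  and volume and turns the radial momentum into the first component.\<close>

lemma integral_rotate_axis:
  fixes G :: "real \<Rightarrow> real \<Rightarrow> real" and x :: "real^3"
  assumes cont: "continuous_on UNIV (\<lambda>(n, c). G n c)" and x: "x \<noteq> 0"
  shows "integral\<^sup>L lborel (\<lambda>v. G (v \<bullet> v) (x \<bullet> v / norm x))
    = integral\<^sup>L lborel (\<lambda>v::real^3. G (v \<bullet> v) (v $ 1))"
proof -
  obtain T :: "real^3 \<Rightarrow> real^3" where T: "orthogonal_transformation T" "det (matrix T) = 1"
    "T (axis 1 1) = x /\<^sub>R norm x"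
    using rotation_exists[of "axis 1 1 :: real^3" "x /\<^sub>R norm x"] x by (auto simp: norm_axis_1)
  have "continuous_on UNIV (\<lambda>v. G (v \<bullet> v) (x \<bullet> v / norm x))"
    using continuous_on_compose2[OF cont, of UNIV "\<lambda>v. (v \<bullet> v, x \<bullet> v / norm x)"] x
    by (simp add: continuous_intros)
  then have "integral\<^sup>L lborel (\<lambda>v. G (v \<bullet> v) (x \<bullet> v / norm x))
    = integral\<^sup>L lborel (\<lambda>v. G (T v \<bullet> T v) (x \<bullet> T v / norm x))"
    using T by (subst lborel_integral_linear[of T])
      (auto simp: orthogonal_transformation_linear intro: borel_measurable_continuous_onI)
  moreover have "T v \<bullet> T v = v \<bullet> v" "x \<bullet> T v / norm x = v $ 1" for v
  proof -
    show "T v \<bullet> T v = v \<bullet> v" using T(1) by (simp add: orthogonal_transformation_def)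
    have "x \<bullet> T v / norm x = T (axis 1 1) \<bullet> T v" by (simp add: T(3) divide_inverse mult.commute)
    also have "\<dots> = axis 1 1 \<bullet> v" using T(1) by (simp add: orthogonal_transformation_def)
    finally show "x \<bullet> T v / norm x = v $ 1" by (simp add: inner_axis')
  qed
  ultimately show ?thesis by simp
qed

section \<open>Support and moments of the momentum profile\<close>

lemma integrable_bounded_support:
  fixes g :: "'a::euclidean_space \<Rightarrow> real"
  assumes "continuous_on UNIV g" "\<And>v. M < v \<bullet> v \<Longrightarrow> g v = 0"
  shows "integrable lborel g"
proof -
  have "integrable lborel (\<lambda>v. indicator (cball 0 (sqrt M)) v *\<^sub>R g v)"
    using assms(1) by (intro borel_integrable_compact continuous_on_subset[OF assms(1)]) auto
  moreover have "(\<lambda>v. indicator (cball 0 (sqrt M)) v *\<^sub>R g v) = g"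
  proof
    fix v
    show "indicator (cball 0 (sqrt M)) v *\<^sub>R g v = g v"
    proof (cases "M < v \<bullet> v")
      case True
      then show ?thesis using assms(2) by simp
    next
      case False
      then have "norm v \<le> sqrt M" by (simp add: norm_eq_sqrt_inner)
      then show ?thesis by simp
    qed
  qed
  ultimately show ?thesis by simp
qed

text \<open>Momentum coordinates: \<open>v $ 1\<close> is the radial component and \<open>v \<bullet> v - (v $ 1)\<^sup>2\<close> the squared
  tangential momentum.\<close>
definition radial_weight :: "real^3 \<Rightarrow> real" where
  "radial_weight v = pos_part32 ((v \<bullet> v - (v $ 1)\<^sup>2) - (v $ 1)\<^sup>2) * (max 0 (1 - (v \<bullet> v - (v $ 1)\<^sup>2)))\<^sup>2"

text \<open>Its value is never computed: the amplitude of \<open>f\<close> is divided by it, so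
  positivity suffices.\<close>

definition radial_moment :: real where
  "radial_moment = integral\<^sup>L lborel (\<lambda>v. (v $ 1)\<^sup>2 * radial_weight v)"

lemma radial_weight_nonneg: "0 \<le> radial_weight v"
  by (simp add: radial_weight_def pos_part32_nonneg)

lemma continuous_on_radial_weight: "continuous_on S radial_weight"
  unfolding radial_weight_def[abs_def] by (intro continuous_intros)

lemma tangential_support:
  fixes n w :: real
  assumes "a * (n - w\<^sup>2) > w\<^sup>2" "n - w\<^sup>2 < 1" "0 < a"
  shows "n \<le> 1 + a"
proof -
  have "a * (n - w\<^sup>2) \<le> a * 1" using assms by (intro mult_left_mono) auto
  then show ?thesis using assms by linarith
qed

lemma radial_weight_support: "2 < v \<bullet> v \<Longrightarrow> radial_weight v = 0"
  using tangential_support[of 1 "v \<bullet> v" "v $ 1"]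
  by (cases "(v $ 1)\<^sup>2 < v \<bullet> v - (v $ 1)\<^sup>2"; cases "v \<bullet> v - (v $ 1)\<^sup>2 < 1")
    (auto simp: radial_weight_def pos_part32_eq_0)

lemma integrable_radial_weight:
  assumes "continuous_on UNIV g"
  shows "integrable lborel (\<lambda>v. g v * radial_weight v)"
  using assms radial_weight_support
  by (intro integrable_bounded_support[of _ 2] continuous_intros continuous_on_radial_weight) auto

text \<open>Stretching the radial momenta by \<open>sqrt a\<close> multiplies the integral of
  \<open>(a s - w\<^sup>2)\<^bsub>+\<^esub>\<^bsup>5/2\<^esup>\<close> by \<open>a\<^sup>3\<close>; comparing with the tangent inequality at \<open>a = 1\<close> yields
  the ratio of the two second moments.\<close>
lemma tangential_moment:
  "integral\<^sup>L lborel (\<lambda>v. (v \<bullet> v - (v $ 1)\<^sup>2) * radial_weight v) = 6 * radial_moment"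
proof -
  define h where "h = (\<lambda>t. t * pos_part32 t)"
  define c where "c = (\<lambda>s::real. (max 0 (1 - s))\<^sup>2)"
  define J where "J = (\<lambda>a. integral\<^sup>L lborel (\<lambda>v::real^3. h (a * (v \<bullet> v - (v $ 1)\<^sup>2) - (v $ 1)\<^sup>2) * c (v \<bullet> v - (v $ 1)\<^sup>2)))"
  define I0 where "I0 = integral\<^sup>L lborel (\<lambda>v. (v \<bullet> v - (v $ 1)\<^sup>2) * radial_weight v)"
  have h_mult: "h (a * t) = a\<^sup>2 * sqrt a * h t" if "0 < a" for a t
    using that by (simp add: h_def pos_part32_mult power2_eq_square)
  have int: "integrable lborel (\<lambda>v. (v \<bullet> v - (v $ 1)\<^sup>2) * radial_weight v)"
    "integrable lborel (\<lambda>v. (v $ 1)\<^sup>2 * radial_weight v)"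
    by (intro integrable_radial_weight continuous_intros)+
  have int_J: "integrable lborel (\<lambda>v::real^3. h (a * (v \<bullet> v - (v $ 1)\<^sup>2) - (v $ 1)\<^sup>2) * c (v \<bullet> v - (v $ 1)\<^sup>2))"
    if "0 < a" for a
  proof (rule integrable_bounded_support[of _ "1 + a"])
    show "continuous_on UNIV (\<lambda>v::real^3. h (a * (v \<bullet> v - (v $ 1)\<^sup>2) - (v $ 1)\<^sup>2) * c (v \<bullet> v - (v $ 1)\<^sup>2))"
      unfolding h_def c_def by (intro continuous_intros)
    fix v :: "real^3" assume "1 + a < v \<bullet> v"
    then show "h (a * (v \<bullet> v - (v $ 1)\<^sup>2) - (v $ 1)\<^sup>2) * c (v \<bullet> v - (v $ 1)\<^sup>2) = 0"
      using tangential_support[of "v $ 1" a "v \<bullet> v"] that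
      by (cases "(v $ 1)\<^sup>2 < a * (v \<bullet> v - (v $ 1)\<^sup>2)"; cases "v \<bullet> v - (v $ 1)\<^sup>2 < 1")
        (auto simp: h_def c_def pos_part32_eq_0)
  qed
  have J1: "J 1 = I0 - radial_moment"
    unfolding J_def I0_def radial_moment_def
    by (subst Bochner_Integration.integral_diff[OF int, symmetric])
       (simp add: h_def c_def radial_weight_def algebra_simps)
  have J_scale: "J a = a ^ 3 * J 1" if a: "0 < a" for a
  proof -
    have "J a = sqrt a * 1\<^sup>2 * integral\<^sup>L lborel (\<lambda>v::real^3.
        h (a * (((sqrt a)\<^sup>2 * (v $ 1)\<^sup>2 + 1\<^sup>2 * (v \<bullet> v - (v $ 1)\<^sup>2)) - (sqrt a * v $ 1)\<^sup>2) - (sqrt a * v $ 1)\<^sup>2)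
        * c (((sqrt a)\<^sup>2 * (v $ 1)\<^sup>2 + 1\<^sup>2 * (v \<bullet> v - (v $ 1)\<^sup>2)) - (sqrt a * v $ 1)\<^sup>2))"
      unfolding J_def
      by (rule integral_axis_scaling[where G = "\<lambda>n w. h (a * (n - w\<^sup>2) - w\<^sup>2) * c (n - w\<^sup>2)"])
        (use a in \<open>auto simp: h_def c_def split_def intro!: continuous_intros\<close>)
    also have "(\<lambda>v::real^3.
        h (a * (((sqrt a)\<^sup>2 * (v $ 1)\<^sup>2 + 1\<^sup>2 * (v \<bullet> v - (v $ 1)\<^sup>2)) - (sqrt a * v $ 1)\<^sup>2) - (sqrt a * v $ 1)\<^sup>2)
        * c (((sqrt a)\<^sup>2 * (v $ 1)\<^sup>2 + 1\<^sup>2 * (v \<bullet> v - (v $ 1)\<^sup>2)) - (sqrt a * v $ 1)\<^sup>2))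
      = (\<lambda>v::real^3. (a\<^sup>2 * sqrt a) * (h (1 * (v \<bullet> v - (v $ 1)\<^sup>2) - (v $ 1)\<^sup>2) * c (v \<bullet> v - (v $ 1)\<^sup>2)))"
    proof
      fix v :: "real^3"
      have e: "((sqrt a)\<^sup>2 * (v $ 1)\<^sup>2 + 1\<^sup>2 * (v \<bullet> v - (v $ 1)\<^sup>2)) - (sqrt a * v $ 1)\<^sup>2 = v \<bullet> v - (v $ 1)\<^sup>2"
        by (simp add: power_mult_distrib)
      have e': "a * (v \<bullet> v - (v $ 1)\<^sup>2) - (sqrt a * v $ 1)\<^sup>2 = a * (1 * (v \<bullet> v - (v $ 1)\<^sup>2) - (v $ 1)\<^sup>2)"
        using a by (simp add: power_mult_distrib algebra_simps)
      show "h (a * (((sqrt a)\<^sup>2 * (v $ 1)\<^sup>2 + 1\<^sup>2 * (v \<bullet> v - (v $ 1)\<^sup>2)) - (sqrt a * v $ 1)\<^sup>2) - (sqrt a * v $ 1)\<^sup>2)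
        * c (((sqrt a)\<^sup>2 * (v $ 1)\<^sup>2 + 1\<^sup>2 * (v \<bullet> v - (v $ 1)\<^sup>2)) - (sqrt a * v $ 1)\<^sup>2)
       = (a\<^sup>2 * sqrt a) * (h (1 * (v \<bullet> v - (v $ 1)\<^sup>2) - (v $ 1)\<^sup>2) * c (v \<bullet> v - (v $ 1)\<^sup>2))"
        unfolding e e' h_mult[OF a] by simp
    qed
    also have "sqrt a * 1\<^sup>2 * integral\<^sup>L lborel \<dots> = (sqrt a * sqrt a) * a\<^sup>2 * J 1"
      unfolding J_def by simp
    also have "\<dots> = a ^ 3 * J 1" using a by (simp add: power2_eq_square power3_eq_cube)
    finally show ?thesis .
  qed
  have ge: "J 1 + 5/2 * (a - 1) * I0 \<le> a ^ 3 * J 1" if a: "0 < a" for a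
  proof -
    have expand: "(X + 5/2 * p * ((a * s - w) - (s - w))) * k = X * k + 5/2 * (a - 1) * (s * (p * k))"
      for X p s w k :: real by (simp add: field_simps)
    have "J 1 + 5/2 * (a - 1) * I0 = integral\<^sup>L lborel (\<lambda>v::real^3.
      h (1 * (v \<bullet> v - (v $ 1)\<^sup>2) - (v $ 1)\<^sup>2) * c (v \<bullet> v - (v $ 1)\<^sup>2)
      + 5/2 * (a - 1) * ((v \<bullet> v - (v $ 1)\<^sup>2) * radial_weight v))"
      unfolding J_def I0_def
      by (subst Bochner_Integration.integral_add) (use int int_J[of 1] in auto)
    also have "\<dots> \<le> J a"
      unfolding J_def
    proof (rule integral_mono)
      fix v :: "real^3"
      let ?s = "v \<bullet> v - (v $ 1)\<^sup>2" and ?w = "(v $ 1)\<^sup>2"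
      have "(h (1 * ?s - ?w) + 5/2 * pos_part32 (?s - ?w) * ((a * ?s - ?w) - (?s - ?w))) * c ?s \<le> h (a * ?s - ?w) * c ?s"
        using pos_part52_tangent[of "?s - ?w" "a * ?s - ?w"]
        by (intro mult_right_mono) (auto simp: h_def c_def)
      moreover have "(h (1 * ?s - ?w) + 5/2 * pos_part32 (?s - ?w) * ((a * ?s - ?w) - (?s - ?w))) * c ?s
          = h (1 * ?s - ?w) * c ?s + 5/2 * (a - 1) * (?s * (pos_part32 (?s - ?w) * c ?s))"
        by (rule expand)
      ultimately show "h (1 * ?s - ?w) * c ?s + 5/2 * (a - 1) * (?s * radial_weight v) \<le> h (a * ?s - ?w) * c ?s"
        by (simp add: radial_weight_def c_def)
    qed (use int int_J[of 1] int_J[OF a] in auto)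
    finally show ?thesis unfolding J_scale[OF a] .
  qed
  \<comment> \<open>By \<open>ge\<close> the difference is minimal at \<open>a = 1\<close>, so its
    derivative vanishes there. Combined with \<open>J 1 = I0 - radial_moment\<close> this gives the
    factor 6.\<close>
  have "3 * J 1 - 5/2 * I0 = 0"
  proof (rule DERIV_local_min[of "\<lambda>a. a ^ 3 * J 1 - 5/2 * (a - 1) * I0" _ 1 1])
    show "((\<lambda>a. a ^ 3 * J 1 - 5/2 * (a - 1) * I0) has_real_derivative 3 * J 1 - 5/2 * I0) (at 1)"
      by (auto intro!: derivative_eq_intros)
    show "\<forall>y. \<bar>1 - y\<bar> < 1 \<longrightarrow> 1 ^ 3 * J 1 - 5/2 * (1 - 1) * I0 \<le> y ^ 3 * J 1 - 5/2 * (y - 1) * I0"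
      using ge by (force simp: abs_less_iff)
  qed simp
  then have "I0 = 6 * radial_moment" using J1 by simp
  then show ?thesis by (simp add: I0_def)
qed

lemma radial_moment_pos: "0 < radial_moment"
proof -
  have nonneg: "0 \<le> (v $ 1)\<^sup>2 * radial_weight v" for v by (simp add: radial_weight_nonneg)
  have cont: "continuous_on UNIV (\<lambda>v::real^3. (v $ 1)\<^sup>2 * radial_weight v)"
    by (intro continuous_intros continuous_on_radial_weight)
  \<comment> \<open>A point inside the support: the squared radial momentum 1/16 is below the
    squared tangential momentum 1/4, which is below 1. The open set where the integrand is positive
    is thus nonempty.\<close>
  define v0 :: "real^3" where "v0 = vector [1/4, 1/2, 0]"
  have c: "v0 $ 1 = 1/4" "v0 $ 2 = 1/2" "v0 $ 3 = 0" by (simp_all add: v0_def)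
  have "v0 \<bullet> v0 = 5/16" by (simp add: inner_vec_def sum_3 c)
  then have v0: "0 < (v0 $ 1)\<^sup>2 * radial_weight v0"
    by (simp add: radial_weight_def pos_part32_def c power2_eq_square)
  have int: "integrable lborel (\<lambda>v::real^3. (v $ 1)\<^sup>2 * radial_weight v)"
    by (intro integrable_radial_weight continuous_intros)
  have "radial_moment \<noteq> 0"
  proof
    assume "radial_moment = 0"
    then have AE: "AE v in lborel. (v $ 1)\<^sup>2 * radial_weight v = 0"
      using integral_nonneg_eq_0_iff_AE[OF int] nonneg by (simp add: radial_moment_def)
    have op: "open {v::real^3. (v $ 1)\<^sup>2 * radial_weight v > 0}"
      by (intro open_Collect_less continuous_on_const cont)
    have "{v::real^3. (v $ 1)\<^sup>2 * radial_weight v > 0} \<in> null_sets lborel"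
    proof (rule AE_iff_null_sets[THEN iffD2])
      show "{v::real^3. (v $ 1)\<^sup>2 * radial_weight v > 0} \<in> sets lborel"
        unfolding sets_lborel using op by (rule borel_open)
      show "AE v in lborel. v \<notin> {v::real^3. (v $ 1)\<^sup>2 * radial_weight v > 0}"
        using AE by eventually_elim auto
    qed
    then have "negligible {v::real^3. (v $ 1)\<^sup>2 * radial_weight v > 0}"
      by (simp add: negligible_iff_null_sets null_sets_completionI)
    then have "{v::real^3. (v $ 1)\<^sup>2 * radial_weight v > 0} = {}"
      using open_not_negligible[OF op] by blast
    with v0 show False by auto
  qed
  moreover have "0 \<le> radial_moment"
    unfolding radial_moment_def by (intro Bochner_Integration.integral_nonneg nonneg)
  ultimately show ?thesis by simp
qed

section \<open>Photon densities\<close>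

text \<open>\<open>e\<close> is the square of the energy, whence the factor \<open>sqrt e\<close>;
  the square on the last factor keeps it differentiable at the cut-off \<open>L = 1\<close>.\<close>

definition emission :: "real \<Rightarrow> real \<Rightarrow> real" where
  "emission e L = sqrt e * (pos_part32 (L - e) * (max 0 (1 - L))\<^sup>2)"

text \<open>By Lagrange's identity the second argument of \<open>emission\<close> is the squared
  norm of the cross product of \<open>x\<close> and \<open>v\<close>.\<close>

definition photon_density :: "(real \<Rightarrow> real) \<Rightarrow> real \<Rightarrow> real \<Rightarrow> pdens" where
  "photon_density A r1 c x v = (if norm x < r1
     then c * emission (A (norm x) * (v \<bullet> v)) ((x \<bullet> x) * (v \<bullet> v) - (x \<bullet> v)\<^sup>2) else 0)"

lemma emission_nonneg: "0 \<le> e \<Longrightarrow> 0 \<le> emission e L"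
  by (simp add: emission_def pos_part32_nonneg)

lemma emission_eq_0: "L \<le> e \<Longrightarrow> emission e L = 0"
  by (simp add: emission_def pos_part32_eq_0)

lemma emission_eq_0': "1 \<le> L \<Longrightarrow> emission e L = 0"
  by (simp add: emission_def)

lemma continuous_on_emission [continuous_intros]:
  "continuous_on S f \<Longrightarrow> continuous_on S g \<Longrightarrow> continuous_on S (\<lambda>x. emission (f x) (g x))"
  unfolding emission_def by (intro continuous_intros)

text \<open>\<open>emission\<close> sees \<open>z\<close> only through \<open>E\<close> and
  \<open>L\<close>, so a direction annihilated by both differentials is annihilated by
  \<open>D\<close>; this is how conserved quantities solve the Vlasov equation. Positivity of
  \<open>E\<close> makes \<open>sqrt\<close> differentiable.\<close>

lemma emission_has_derivative:
  assumes E: "(E has_derivative E') (at z)" and L: "(L has_derivative L') (at z)" and pos: "0 < E z"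
  obtains D where "((\<lambda>z. emission (E z) (L z)) has_derivative D) (at z)"
    "\<And>k. E' k = 0 \<Longrightarrow> L' k = 0 \<Longrightarrow> D k = 0"
proof -
  have 1: "((\<lambda>z. sqrt (E z)) has_derivative (\<lambda>k. E' k * (inverse (sqrt (E z)) / 2))) (at z)"
    by (rule DERIV_compose_FDERIV[OF DERIV_real_sqrt[OF pos] E])
  have 2: "((\<lambda>z. pos_part32 (L z - E z)) has_derivative
      (\<lambda>k. (L' k - E' k) * (3/2 * sqrt (max 0 (L z - E z))))) (at z)"
    by (rule DERIV_compose_FDERIV[OF DERIV_pos_part32 has_derivative_diff[OF L E]])
  have "((\<lambda>z. 1 - L z) has_derivative (\<lambda>k. - L' k)) (at z)"
    using has_derivative_diff[OF has_derivative_const L] by simp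
  from DERIV_compose_FDERIV[OF DERIV_pos_part_power[of 2] this]
  have 3: "((\<lambda>z. (max 0 (1 - L z))\<^sup>2) has_derivative (\<lambda>k. - L' k * (2 * max 0 (1 - L z)))) (at z)"
    by simp
  show thesis
    by (rule that[unfolded emission_def, OF has_derivative_mult[OF 1 has_derivative_mult[OF 2 3]]]) simp
qed

text \<open>After a rotation, radial momenta are scaled by \<open>sqrt (b / a)\<close> and
  tangential ones by \<open>1 / r\<close>. Then \<open>L\<close> becomes the squared tangential
  component \<open>s\<close>, and \<open>L - E^2\<close> becomes \<open>b * (s - w\<^sup>2)\<close>
  since \<open>a / r\<^sup>2 = 1 - b\<close>; powers of \<open>b\<close> factor out and
  \<open>radial_weight\<close> remains. The density uses \<open>q n w = n\<close>, the pressure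
  \<open>q n w = w\<^sup>2\<close>.\<close>

lemma emission_moment:
  fixes q :: "real \<Rightarrow> real \<Rightarrow> real" and x :: "real^3"
  assumes x: "x \<noteq> 0" and a: "0 < a" and b: "0 < b" "b = 1 - a / (norm x)\<^sup>2"
    and q: "continuous_on UNIV (\<lambda>(n, w). q n w)"
  shows "integral\<^sup>L lborel (\<lambda>v. sqrt a * (pos_part32 ((x \<bullet> x) * (v \<bullet> v) - (x \<bullet> v)\<^sup>2 - a * (v \<bullet> v))
        * (max 0 (1 - ((x \<bullet> x) * (v \<bullet> v) - (x \<bullet> v)\<^sup>2)))\<^sup>2) * q (v \<bullet> v) (x \<bullet> v / norm x))
    = b\<^sup>2 / (norm x)\<^sup>2 * integral\<^sup>L lborel (\<lambda>v. q (b / a * (v $ 1)\<^sup>2 + (v \<bullet> v - (v $ 1)\<^sup>2) / (norm x)\<^sup>2)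
        (sqrt (b / a) * v $ 1) * radial_weight v)"
proof -
  define r where "r = norm x"
  have r: "0 < r" using x by (simp add: r_def)
  define G where "G = (\<lambda>n w. sqrt a * (pos_part32 (r\<^sup>2 * (n - w\<^sup>2) - a * n)
        * (max 0 (1 - r\<^sup>2 * (n - w\<^sup>2)))\<^sup>2) * q n w)"
  have G: "continuous_on UNIV (\<lambda>(n, w). G n w)"
    using q unfolding G_def split_def by (intro continuous_intros)
  have L: "(x \<bullet> x) * (v \<bullet> v) - (x \<bullet> v)\<^sup>2 = r\<^sup>2 * (v \<bullet> v - (x \<bullet> v / r)\<^sup>2)" for v
    using r by (simp add: right_diff_distrib power_divide) (simp add: r_def power2_norm_eq_inner)
  have "integral\<^sup>L lborel (\<lambda>v. sqrt a * (pos_part32 ((x \<bullet> x) * (v \<bullet> v) - (x \<bullet> v)\<^sup>2 - a * (v \<bullet> v))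
        * (max 0 (1 - ((x \<bullet> x) * (v \<bullet> v) - (x \<bullet> v)\<^sup>2)))\<^sup>2) * q (v \<bullet> v) (x \<bullet> v / norm x))
    = integral\<^sup>L lborel (\<lambda>v. G (v \<bullet> v) (x \<bullet> v / norm x))"
    unfolding L G_def r_def[symmetric] by (rule refl)
  also have "\<dots> = integral\<^sup>L lborel (\<lambda>v::real^3. G (v \<bullet> v) (v $ 1))"
    by (rule integral_rotate_axis[OF G x])
  also have "\<dots> = sqrt (b / a) * (1 / r)\<^sup>2 * integral\<^sup>L lborel (\<lambda>v::real^3.
      G ((sqrt (b / a))\<^sup>2 * (v $ 1)\<^sup>2 + (1 / r)\<^sup>2 * (v \<bullet> v - (v $ 1)\<^sup>2)) (sqrt (b / a) * v $ 1))"
    by (rule integral_axis_scaling[OF G]) (use a b r in auto)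
  also have "(\<lambda>v::real^3. G ((sqrt (b / a))\<^sup>2 * (v $ 1)\<^sup>2 + (1 / r)\<^sup>2 * (v \<bullet> v - (v $ 1)\<^sup>2)) (sqrt (b / a) * v $ 1))
    = (\<lambda>v. (sqrt a * b * sqrt b) * (q (b / a * (v $ 1)\<^sup>2 + (v \<bullet> v - (v $ 1)\<^sup>2) / r\<^sup>2) (sqrt (b / a) * v $ 1) * radial_weight v))"
  proof
    fix v :: "real^3"
    define s w where "s = v \<bullet> v - (v $ 1)\<^sup>2" and "w = v $ 1"
    have n: "(sqrt (b / a))\<^sup>2 * w\<^sup>2 + (1 / r)\<^sup>2 * s = b / a * w\<^sup>2 + s / r\<^sup>2"
      using a b by (simp add: power_divide)
    have L: "r\<^sup>2 * (b / a * w\<^sup>2 + s / r\<^sup>2 - (sqrt (b / a) * w)\<^sup>2) = s"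
      using a b r by (simp add: power_mult_distrib)
    have "a / r\<^sup>2 = 1 - b" using b by (simp add: r_def)
    then have "a * (b / a * w\<^sup>2 + s / r\<^sup>2) = b * w\<^sup>2 + (1 - b) * s"
      using a by (simp add: distrib_left) (metis times_divide_eq_left)
    then have e: "s - a * (b / a * w\<^sup>2 + s / r\<^sup>2) = b * (s - w\<^sup>2)"
      by (simp add: algebra_simps)
    have rw: "radial_weight v = pos_part32 (s - w\<^sup>2) * (max 0 (1 - s))\<^sup>2"
      by (simp add: radial_weight_def s_def w_def)
    show "G ((sqrt (b / a))\<^sup>2 * (v $ 1)\<^sup>2 + (1 / r)\<^sup>2 * (v \<bullet> v - (v $ 1)\<^sup>2)) (sqrt (b / a) * v $ 1)
      = (sqrt a * b * sqrt b) * (q (b / a * (v $ 1)\<^sup>2 + (v \<bullet> v - (v $ 1)\<^sup>2) / r\<^sup>2) (sqrt (b / a) * v $ 1) * radial_weight v)"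
      by (unfold s_def[symmetric], unfold w_def[symmetric] rw, unfold n G_def, unfold L e)
        (use b(1) in \<open>simp add: pos_part32_mult\<close>)
  qed
  also have "sqrt (b / a) * (1 / r)\<^sup>2 * integral\<^sup>L lborel (\<lambda>v. (sqrt a * b * sqrt b) *
      (q (b / a * (v $ 1)\<^sup>2 + (v \<bullet> v - (v $ 1)\<^sup>2) / r\<^sup>2) (sqrt (b / a) * v $ 1) * radial_weight v))
    = (sqrt (b / a) * sqrt a * sqrt b) * b / r\<^sup>2 * integral\<^sup>L lborel (\<lambda>v.
      q (b / a * (v $ 1)\<^sup>2 + (v \<bullet> v - (v $ 1)\<^sup>2) / r\<^sup>2) (sqrt (b / a) * v $ 1) * radial_weight v)"
    by (simp add: power_divide)
  also have "sqrt (b / a) * sqrt a * sqrt b = b"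
    using a b by (simp add: real_sqrt_divide)
  finally show ?thesis unfolding r_def by (simp add: power2_eq_square)
qed

section \<open>Matter quantities of a photon density\<close>

context
  fixes A :: "real \<Rightarrow> real" and r1 c :: real and x :: "real^3"
  assumes A_pos: "0 < A (norm x)"
begin

lemma photon_density_integrable:
  assumes "continuous_on UNIV g"
  shows "integrable lborel (\<lambda>v. photon_density A r1 c x v * g v)"
proof (cases "norm x < r1")
  case True
  have "integrable lborel (\<lambda>v. c * emission (A (norm x) * (v \<bullet> v)) ((x \<bullet> x) * (v \<bullet> v) - (x \<bullet> v)\<^sup>2) * g v)"
  proof (rule integrable_bounded_support[of _ "1 / A (norm x)"])
    show "continuous_on UNIV (\<lambda>v. c * emission (A (norm x) * (v \<bullet> v)) ((x \<bullet> x) * (v \<bullet> v) - (x \<bullet> v)\<^sup>2) * g v)"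
      by (intro continuous_intros assms)
    fix v :: "real^3" assume "1 / A (norm x) < v \<bullet> v"
    then have "1 < A (norm x) * (v \<bullet> v)" using A_pos by (simp add: pos_divide_less_eq mult.commute)
    then have "emission (A (norm x) * (v \<bullet> v)) ((x \<bullet> x) * (v \<bullet> v) - (x \<bullet> v)\<^sup>2) = 0"
      by (cases "(x \<bullet> x) * (v \<bullet> v) - (x \<bullet> v)\<^sup>2 \<ge> 1") (auto intro: emission_eq_0 emission_eq_0')
    then show "c * emission (A (norm x) * (v \<bullet> v)) ((x \<bullet> x) * (v \<bullet> v) - (x \<bullet> v)\<^sup>2) * g v = 0" by simp
  qed
  with True show ?thesis by (simp add: photon_density_def)
qed (simp add: photon_density_def)

lemma photon_density_eq_0:
  assumes "r1 \<le> norm x \<or> (norm x)\<^sup>2 \<le> A (norm x)"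
  shows "photon_density A r1 c x v = 0"
proof (cases "norm x < r1")
  case True
  then have "(x \<bullet> x) * (v \<bullet> v) \<le> A (norm x) * (v \<bullet> v)"
    using assms by (intro mult_right_mono) (auto simp: power2_norm_eq_inner)
  then have "emission (A (norm x) * (v \<bullet> v)) ((x \<bullet> x) * (v \<bullet> v) - (x \<bullet> v)\<^sup>2) = 0"
    by (intro emission_eq_0) (smt (verit) zero_le_power2)
  then show ?thesis by (simp add: photon_density_def)
qed (simp add: photon_density_def)

text \<open>Since \<^const>\<open>emission\<close> is proportional to \<open>sqrt e\<close>, the factor \<open>norm v\<close> cancels in the
  pressures (also at \<open>v = 0\<close>, where \<^const>\<open>emission\<close> vanishes).\<close>
lemma photon_density_div_norm:
  "photon_density A r1 c x v / norm v = (if norm x < r1 then c * (sqrt (A (norm x)) *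
     (pos_part32 ((x \<bullet> x) * (v \<bullet> v) - (x \<bullet> v)\<^sup>2 - A (norm x) * (v \<bullet> v))
        * (max 0 (1 - ((x \<bullet> x) * (v \<bullet> v) - (x \<bullet> v)\<^sup>2)))\<^sup>2)) else 0)"
proof (cases "v = 0")
  case True
  then show ?thesis by (simp add: pos_part32_def)
next
  case False
  then show ?thesis
    by (simp add: photon_density_def emission_def real_sqrt_mult norm_eq_sqrt_inner)
qed

lemma photon_density_div_norm_integrable:
  assumes "continuous_on UNIV g"
  shows "integrable lborel (\<lambda>v. photon_density A r1 c x v / norm v * g v)"
proof (cases "norm x < r1")
  case True
  have "integrable lborel (\<lambda>v. c * (sqrt (A (norm x)) *
     (pos_part32 ((x \<bullet> x) * (v \<bullet> v) - (x \<bullet> v)\<^sup>2 - A (norm x) * (v \<bullet> v))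
        * (max 0 (1 - ((x \<bullet> x) * (v \<bullet> v) - (x \<bullet> v)\<^sup>2)))\<^sup>2)) * g v)"
  proof (rule integrable_bounded_support[of _ "1 / A (norm x)"])
    show "continuous_on UNIV (\<lambda>v. c * (sqrt (A (norm x)) *
     (pos_part32 ((x \<bullet> x) * (v \<bullet> v) - (x \<bullet> v)\<^sup>2 - A (norm x) * (v \<bullet> v))
        * (max 0 (1 - ((x \<bullet> x) * (v \<bullet> v) - (x \<bullet> v)\<^sup>2)))\<^sup>2)) * g v)"
      by (intro continuous_intros assms)
    fix v :: "real^3" assume "1 / A (norm x) < v \<bullet> v"
    then have "1 < A (norm x) * (v \<bullet> v)" using A_pos by (simp add: pos_divide_less_eq mult.commute)
    then show "c * (sqrt (A (norm x)) *
     (pos_part32 ((x \<bullet> x) * (v \<bullet> v) - (x \<bullet> v)\<^sup>2 - A (norm x) * (v \<bullet> v))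
        * (max 0 (1 - ((x \<bullet> x) * (v \<bullet> v) - (x \<bullet> v)\<^sup>2)))\<^sup>2)) * g v = 0"
      by (cases "(x \<bullet> x) * (v \<bullet> v) - (x \<bullet> v)\<^sup>2 \<ge> 1") (auto simp: pos_part32_eq_0)
  qed
  with True show ?thesis unfolding photon_density_div_norm by simp
qed (simp add: photon_density_def)

lemma rho_photon_density:
  assumes x: "x \<noteq> 0" "norm x < r1" and b: "b = max 0 (1 - A (norm x) / (norm x)\<^sup>2)"
  shows "rho (photon_density A r1 c) x
    = c * radial_moment * b\<^sup>2 * (6 - 5 * b) / (A (norm x) * (norm x)\<^sup>2)"
proof (cases "b > 0")
  case False
  then have "1 - A (norm x) / (norm x)\<^sup>2 \<le> 0" using b by simp
  then have "(norm x)\<^sup>2 \<le> A (norm x)" using x by (simp add: field_simps)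
  then show ?thesis using False b photon_density_eq_0 by (simp add: rho_def)
next
  case True
  then have b': "b = 1 - A (norm x) / (norm x)\<^sup>2" using b by auto
  define a r where "a = A (norm x)" and "r = norm x"
  have ar: "0 < a" "0 < r" using A_pos x by (auto simp: a_def r_def)
  have "1 / r\<^sup>2 = (1 - b) / a" using b' ar by (simp add: a_def r_def)
  have "rho (photon_density A r1 c) x = c * integral\<^sup>L lborel (\<lambda>v. sqrt a *
      (pos_part32 ((x \<bullet> x) * (v \<bullet> v) - (x \<bullet> v)\<^sup>2 - a * (v \<bullet> v))
        * (max 0 (1 - ((x \<bullet> x) * (v \<bullet> v) - (x \<bullet> v)\<^sup>2)))\<^sup>2) * (v \<bullet> v))"
    unfolding rho_def integral_mult_right_zero[symmetric]
  proof (rule Bochner_Integration.integral_cong[OF refl])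
    fix v :: "real^3"
    have "sqrt (a * (v \<bullet> v)) * norm v = sqrt a * (v \<bullet> v)"
      by (simp add: real_sqrt_mult norm_eq_sqrt_inner)
    then show "photon_density A r1 c x v * norm v = c * (sqrt a *
      (pos_part32 ((x \<bullet> x) * (v \<bullet> v) - (x \<bullet> v)\<^sup>2 - a * (v \<bullet> v))
        * (max 0 (1 - ((x \<bullet> x) * (v \<bullet> v) - (x \<bullet> v)\<^sup>2)))\<^sup>2) * (v \<bullet> v))"
      using x by (simp add: photon_density_def emission_def flip: a_def)
  qed
  also have "integral\<^sup>L lborel (\<lambda>v. sqrt a *
      (pos_part32 ((x \<bullet> x) * (v \<bullet> v) - (x \<bullet> v)\<^sup>2 - a * (v \<bullet> v))
        * (max 0 (1 - ((x \<bullet> x) * (v \<bullet> v) - (x \<bullet> v)\<^sup>2)))\<^sup>2) * (v \<bullet> v))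
    = b\<^sup>2 / r\<^sup>2 * integral\<^sup>L lborel (\<lambda>v. (b / a * (v $ 1)\<^sup>2 + (v \<bullet> v - (v $ 1)\<^sup>2) / r\<^sup>2) * radial_weight v)"
    unfolding r_def
    by (rule emission_moment[of x a b "\<lambda>n w. n"])
      (use x ar True b' in \<open>auto simp: a_def split_def intro!: continuous_intros\<close>)
  also have "(\<lambda>v. (b / a * (v $ 1)\<^sup>2 + (v \<bullet> v - (v $ 1)\<^sup>2) / r\<^sup>2) * radial_weight v)
      = (\<lambda>v. b / a * ((v $ 1)\<^sup>2 * radial_weight v) + 1 / r\<^sup>2 * ((v \<bullet> v - (v $ 1)\<^sup>2) * radial_weight v))"
    by (simp add: fun_eq_iff distrib_right)
  \<comment> \<open>The tangential moment is 6 times the radial one; with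
    \<open>1 / r\<^sup>2 = (1 - b) / a\<close> the sum has the coefficient
    \<open>b + 6 * (1 - b) = 6 - 5 * b\<close>.\<close>
  also have "integral\<^sup>L lborel \<dots> = b / a * radial_moment + 1 / r\<^sup>2 * (6 * radial_moment)"
    by (subst Bochner_Integration.integral_add)
      (auto intro!: integrable_mult_right integrable_radial_weight continuous_intros
        simp: tangential_moment simp flip: radial_moment_def)
  also have "\<dots> = radial_moment * (6 - 5 * b) / a"
    unfolding \<open>1 / r\<^sup>2 = (1 - b) / a\<close> using ar by (simp add: field_simps)
  finally show ?thesis by (simp add: a_def r_def mult_ac)
qed

lemma prad_photon_density:
  assumes x: "x \<noteq> 0" "norm x < r1" and b: "b = max 0 (1 - A (norm x) / (norm x)\<^sup>2)"
  shows "prad (photon_density A r1 c) x = c * radial_moment * b ^ 3 / (A (norm x) * (norm x)\<^sup>2)"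
proof (cases "b > 0")
  case False
  then have "1 - A (norm x) / (norm x)\<^sup>2 \<le> 0" using b by simp
  then have "(norm x)\<^sup>2 \<le> A (norm x)" using x by (simp add: field_simps)
  then show ?thesis using False b photon_density_eq_0 by (simp add: prad_def)
next
  case True
  then have b': "b = 1 - A (norm x) / (norm x)\<^sup>2" using b by auto
  define a where "a = A (norm x)"
  have a: "0 < a" using A_pos by (auto simp: a_def)
  have "prad (photon_density A r1 c) x = c * integral\<^sup>L lborel (\<lambda>v. sqrt a *
      (pos_part32 ((x \<bullet> x) * (v \<bullet> v) - (x \<bullet> v)\<^sup>2 - a * (v \<bullet> v))
        * (max 0 (1 - ((x \<bullet> x) * (v \<bullet> v) - (x \<bullet> v)\<^sup>2)))\<^sup>2) * (x \<bullet> v / norm x)\<^sup>2)"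
    unfolding prad_def photon_density_div_norm using x by (simp add: mult.assoc flip: a_def)
  also have "integral\<^sup>L lborel (\<lambda>v. sqrt a *
      (pos_part32 ((x \<bullet> x) * (v \<bullet> v) - (x \<bullet> v)\<^sup>2 - a * (v \<bullet> v))
        * (max 0 (1 - ((x \<bullet> x) * (v \<bullet> v) - (x \<bullet> v)\<^sup>2)))\<^sup>2) * (x \<bullet> v / norm x)\<^sup>2)
    = b\<^sup>2 / (norm x)\<^sup>2 * integral\<^sup>L lborel (\<lambda>v. (sqrt (b / a) * v $ 1)\<^sup>2 * radial_weight v)"
    by (rule emission_moment[of x a b "\<lambda>n w. w\<^sup>2"])
      (use x a True b' in \<open>auto simp: a_def split_def intro!: continuous_intros\<close>)
  also have "(\<lambda>v. (sqrt (b / a) * v $ 1)\<^sup>2 * radial_weight v) = (\<lambda>v. b / a * ((v $ 1)\<^sup>2 * radial_weight v))"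
    using True a by (simp add: fun_eq_iff power_mult_distrib)
  also have "integral\<^sup>L lborel \<dots> = b / a * radial_moment"
    by (simp add: radial_moment_def)
  finally show ?thesis by (simp add: a_def power2_eq_square power3_eq_cube mult_ac)
qed

end

section \<open>Symmetry and the Vlasov equation\<close>

lemma photon_density_rotation:
  assumes "rotation_matrix Q"
  shows "photon_density A r1 c (Q *v x) (Q *v v) = photon_density A r1 c x v"
proof -
  have "orthogonal_transformation (\<lambda>x. Q *v x)"
    using assms by (simp add: orthogonal_transformation_matrix rotation_matrix_def)
  then have "(Q *v x) \<bullet> (Q *v y) = x \<bullet> y" for x y
    by (simp add: orthogonal_transformation_def)
  then show ?thesis by (simp add: photon_density_def norm_eq_sqrt_inner)
qed

text \<open>Here \<open>m\<close> stands for the derivative of \<mu> and \<open>k\<close> for the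
  exponential factor. The field annihilates \<open>A |v|^2\<close> because
  \<open>A' = 2 m A\<close>, and the angular momentum because position moves along \<open>v\<close>
  and momentum along \<open>x\<close>. The overlap between \<open>r1\<close> and \<open>r2\<close>
  lets the smooth formula and the zero function cover all points by open sets.\<close>

lemma photon_density_vlasov:
  assumes x: "x \<noteq> 0" and v: "v \<noteq> 0" and pos: "\<And>r. 0 < r \<Longrightarrow> 0 < A r"
    and A: "(A has_real_derivative 2 * m * A (norm x)) (at (norm x))"
    and edge: "r1 < r2" "\<And>r. r1 \<le> r \<Longrightarrow> r < r2 \<Longrightarrow> r\<^sup>2 \<le> A r"
  shows "\<exists>D. ((\<lambda>z. photon_density A r1 c (fst z) (snd z)) has_derivative D) (at (x, v)) \<and>
     D ((k / norm v) *\<^sub>R v, (- (k * norm v * m / norm x)) *\<^sub>R x) = 0"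
proof (cases "norm x < r2")
  case True
  let ?E = "\<lambda>z :: (real^3) \<times> (real^3). A (norm (fst z)) * (snd z \<bullet> snd z)"
  let ?L = "\<lambda>z :: (real^3) \<times> (real^3). (fst z \<bullet> fst z) * (snd z \<bullet> snd z) - (fst z \<bullet> snd z)\<^sup>2"
  let ?k = "((k / norm v) *\<^sub>R v, (- (k * norm v * m / norm x)) *\<^sub>R x)"
  have "((\<lambda>z :: (real^3) \<times> (real^3). norm (fst z)) has_derivative (\<lambda>h. sgn x \<bullet> fst h)) (at (x, v))"
    using has_derivative_compose[OF has_derivative_fst[OF has_derivative_ident], of norm "\<lambda>h. sgn x \<bullet> h" "(x, v)" UNIV]
      has_derivative_norm[OF x] by (simp add: inner_commute)
  from DERIV_compose_FDERIV[OF _ this, of A "2 * m * A (norm x)"] A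
  have "((\<lambda>z. A (norm (fst z))) has_derivative (\<lambda>h. (sgn x \<bullet> fst h) * (2 * m * A (norm x)))) (at (x, v))"
    by simp
  then have E: "(?E has_derivative (\<lambda>h. A (norm x) * (2 * (v \<bullet> snd h))
      + (sgn x \<bullet> fst h) * (2 * m * A (norm x)) * (v \<bullet> v))) (at (x, v))"
    by (auto intro!: derivative_eq_intros simp: inner_commute)
  have L: "(?L has_derivative (\<lambda>h. (x \<bullet> x) * (2 * (v \<bullet> snd h)) + 2 * (x \<bullet> fst h) * (v \<bullet> v)
      - 2 * (x \<bullet> v) * (x \<bullet> snd h + fst h \<bullet> v))) (at (x, v))"
    by (auto intro!: derivative_eq_intros simp: inner_commute)
  have "0 < ?E (x, v)" using pos x v by simp
  then obtain D where D: "((\<lambda>z. emission (?E z) (?L z)) has_derivative D) (at (x, v))"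
    and D0: "\<And>h. A (norm x) * (2 * (v \<bullet> snd h)) + (sgn x \<bullet> fst h) * (2 * m * A (norm x)) * (v \<bullet> v) = 0 \<Longrightarrow>
      (x \<bullet> x) * (2 * (v \<bullet> snd h)) + 2 * (x \<bullet> fst h) * (v \<bullet> v)
      - 2 * (x \<bullet> v) * (x \<bullet> snd h + fst h \<bullet> v) = 0 \<Longrightarrow> D h = 0"
    by (rule emission_has_derivative[OF E L]) auto
  have nv: "v \<bullet> v = norm v * norm v" by (simp add: power2_norm_eq_inner[symmetric] power2_eq_square)
  have "D ?k = 0"
    by (rule D0)
      (use x v in \<open>simp_all add: sgn_div_norm nv inner_commute field_simps power2_norm_eq_inner[symmetric] power2_eq_square\<close>)
  moreover have "((\<lambda>z. photon_density A r1 c (fst z) (snd z)) has_derivative (\<lambda>h. c * D h)) (at (x, v))"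
  proof (rule has_derivative_transform_within_open)
    show "((\<lambda>z. c * emission (?E z) (?L z)) has_derivative (\<lambda>h. c * D h)) (at (x, v))"
      using D by (rule has_derivative_mult_right)
    show "open {z :: (real^3) \<times> (real^3). norm (fst z) < r2 \<and> 0 < norm (fst z)}"
      by (intro open_Collect_conj open_Collect_less continuous_intros)
    show "(x, v) \<in> {z. norm (fst z) < r2 \<and> 0 < norm (fst z)}" using True x by simp
    fix z :: "(real^3) \<times> (real^3)" assume z: "z \<in> {z. norm (fst z) < r2 \<and> 0 < norm (fst z)}"
    show "c * emission (?E z) (?L z) = photon_density A r1 c (fst z) (snd z)"
    proof (cases "norm (fst z) < r1")
      case False
      have "?L z \<le> (norm (fst z))\<^sup>2 * (snd z \<bullet> snd z)"
        by (simp add: power2_norm_eq_inner)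
      also have "\<dots> \<le> ?E z"
        using edge(2)[of "norm (fst z)"] z False by (intro mult_right_mono) auto
      finally show ?thesis using False by (simp add: photon_density_def emission_eq_0)
    qed (simp add: photon_density_def)
  qed
  ultimately show ?thesis by (intro exI[of _ "\<lambda>h. c * D h"]) simp
next
  case False
  have "((\<lambda>z. photon_density A r1 c (fst z) (snd z)) has_derivative (\<lambda>h. 0)) (at (x, v))"
  proof (rule has_derivative_transform_within_open[OF has_derivative_const])
    show "open {z :: (real^3) \<times> (real^3). r1 < norm (fst z)}"
      by (intro open_Collect_less continuous_intros)
  qed (use False edge in \<open>auto simp: photon_density_def\<close>)
  then show ?thesis by blast
qed

section \<open>Gluing in the vacuum regions\<close>

text \<open>Every premise is guarded by the position of \<open>r\<close>, so that a single
  application covers both open branches and the junction, where the one-sided derivatives must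
  agree.\<close>

lemma DERIV_if_le:
  fixes f g :: "real \<Rightarrow> real"
  assumes "r < c \<Longrightarrow> (f has_real_derivative D) (at r)"
    and "c < r \<Longrightarrow> (g has_real_derivative D) (at r)"
    and "r = c \<Longrightarrow> (f has_real_derivative D) (at_left c)"
    and "r = c \<Longrightarrow> (g has_real_derivative D) (at_right c)"
    and "r = c \<Longrightarrow> f c = g c"
  shows "((\<lambda>x. if x \<le> c then f x else g x) has_real_derivative D) (at r)"
proof -
  consider "r < c" | "c < r" | "r = c" by linarith
  then show ?thesis
  proof cases
    case 1
    then show ?thesis
      by (intro has_field_derivative_transform_within_open[OF assms(1), of "{..<c}"]) auto
  next
    case 2
    then show ?thesis
      by (intro has_field_derivative_transform_within_open[OF assms(2), of "{c<..}"]) auto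
  next
    case 3
    let ?h = "\<lambda>x. if x \<le> c then f x else g x"
    have "((\<lambda>x. (?h x - ?h c) / (x - c)) \<longlongrightarrow> D) (at_left c)"
    proof (rule Lim_transform_eventually)
      show "((\<lambda>x. (f x - f c) / (x - c)) \<longlongrightarrow> D) (at_left c)"
        using assms(3)[OF 3] by (simp add: has_field_derivative_iff)
      show "\<forall>\<^sub>F x in at_left c. (f x - f c) / (x - c) = (?h x - ?h c) / (x - c)"
        by (auto simp: eventually_at_filter)
    qed
    moreover have "((\<lambda>x. (?h x - ?h c) / (x - c)) \<longlongrightarrow> D) (at_right c)"
    proof (rule Lim_transform_eventually)
      show "((\<lambda>x. (g x - g c) / (x - c)) \<longlongrightarrow> D) (at_right c)"
        using assms(4)[OF 3] by (simp add: has_field_derivative_iff)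
      show "\<forall>\<^sub>F x in at_right c. (g x - g c) / (x - c) = (?h x - ?h c) / (x - c)"
        using assms(5)[OF 3] by (auto simp: eventually_at_filter)
    qed
    ultimately show ?thesis
      unfolding 3 has_field_derivative_iff by (rule filterlim_split_at)
  qed
qed

section \<open>Flat core, shell and Schwarzschild exterior\<close>

context photon_shell
begin

text \<open>The exterior has mass \<open>r1 * y r1 / 2\<close>; the constant factor in
  \<open>N\<close> makes it equal to \<open>r1\<^sup>2 = A r1\<close> at the edge.\<close>

definition "Y r = (if r \<le> r1 then if r \<le> 1 then 0 else y r else r1 * y r1 / r)"
definition "N r = (if r \<le> r1 then if r \<le> 1 then 1 else A r
  else r1\<^sup>2 * (1 - r1 * y r1 / r) / (1 - y r1))"
definition "b r = (if r < r1 then max 0 (1 - N r / r\<^sup>2) else 0)"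

lemma y1_bounds: "4/5 < y r1" "y r1 < 8/9"
  using bounds[of r1] r1 final by auto

lemma exterior_Y_le:
  assumes "r1 \<le> r"
  shows "r1 * y r1 / r \<le> y r1"
proof -
  have "r1 * y r1 \<le> r * y r1" using assms y1_bounds by (intro mult_right_mono) auto
  then show ?thesis using assms r1 by (simp add: pos_divide_le_eq mult.commute)
qed

lemma Y_nonneg: "0 \<le> Y r"
  using bounds[of r] r1 y1_bounds by (auto simp: Y_def)

lemma Y_less: "Y r < 8/9"
proof (cases "r \<le> r1")
  case True
  then show ?thesis using bounds[of r] by (auto simp: Y_def)
next
  case False
  then have "r1 * y r1 / r < 8/9" using exterior_Y_le[of r] y1_bounds by linarith
  then show ?thesis using False by (simp add: Y_def)
qed

lemma N_pos: "0 < N r"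
proof (cases "r \<le> r1")
  case True
  then show ?thesis using bounds[of r] by (auto simp: N_def)
next
  case False
  then have "0 < 1 - r1 * y r1 / r" using exterior_Y_le[of r] y1_bounds by linarith
  then show ?thesis using False r1 y1_bounds by (simp add: N_def)
qed

lemma Y_r1: "Y r1 = y r1" and N_r1: "N r1 = r1\<^sup>2"
  using r1 final by (auto simp: Y_def N_def)

text \<open>In the core \<open>N r = 1 >= r\<^sup>2\<close>. The centre is excluded because division
  by zero gives \<open>b 0 = 1\<close>.\<close>

lemma b_le_1: "b r = 0" if "r \<le> 1" "0 < r"
proof -
  have "r\<^sup>2 \<le> 1" using that by (simp add: power_le_one)
  then show ?thesis using that r1 by (simp add: b_def N_def)
qed

lemma b_interior: "b r = max 0 (1 - A r / r\<^sup>2)" if "r \<in> {1..r1}"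
  using that r1 init final by (cases "r = r1"; cases "r = 1") (auto simp: b_def N_def)

text \<open>\<open>D 1 = 0\<close> and \<open>E r1 = D r1\<close> match the one-sided slopes at the
  two junctions.\<close>

lemma DERIV_interior:
  assumes "\<And>r. r \<in> {1..r1} \<Longrightarrow> (f has_real_derivative D r) (at r within {1..r1})"
    and "f 1 = c" "D 1 = 0" "0 < r"
    and "r1 \<le> r \<Longrightarrow> (g has_real_derivative E r) (at r)" "E r1 = D r1" "g r1 = f r1"
  shows "((\<lambda>r. if r \<le> r1 then if r \<le> 1 then c else f r else g r) has_real_derivative
    (if r \<le> r1 then if r \<le> 1 then 0 else D r else E r)) (at r)"
proof (rule DERIV_if_le)
  assume "r < r1"
  then show "((\<lambda>r. if r \<le> 1 then c else f r) has_real_derivative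
    (if r \<le> r1 then if r \<le> 1 then 0 else D r else E r)) (at r)"
    using assms(1)[of r] assms(1)[of 1] assms(2,3) r1
    by (intro DERIV_if_le) (auto simp: at_within_Icc_at at_within_Icc_at_right)
next
  assume "r1 < r"
  then show "(g has_real_derivative (if r \<le> r1 then if r \<le> 1 then 0 else D r else E r)) (at r)"
    using assms(5) r1 by simp
next
  assume r: "r = r1"
  have "((\<lambda>r. if r \<le> 1 then c else f r) has_real_derivative D r1) (at r1 within {1..r1})"
    by (rule has_field_derivative_transform_within[OF assms(1), of _ 1]) (use r1 assms(2) in auto)
  then show "((\<lambda>r. if r \<le> 1 then c else f r) has_real_derivative
    (if r \<le> r1 then if r \<le> 1 then 0 else D r else E r)) (at_left r1)"
    using r r1 by (simp add: at_within_Icc_at_left)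
  show "(g has_real_derivative (if r \<le> r1 then if r \<le> 1 then 0 else D r else E r)) (at_right r1)"
    using has_field_derivative_at_within[OF assms(5)] r r1 assms(6) by simp
  show "(if r1 \<le> 1 then c else f r1) = g r1" using r1 assms(7) by simp
qed

lemma Y_deriv:
  assumes r: "0 < r"
  shows "(Y has_real_derivative (K * (b r)\<^sup>2 * (6 - 5 * b r) / N r - Y r) / r) (at r)"
proof -
  have "(Y has_real_derivative (if r \<le> r1 then if r \<le> 1 then 0 else
      (K * (max 0 (1 - A r / r\<^sup>2))\<^sup>2 * (6 - 5 * max 0 (1 - A r / r\<^sup>2)) / A r - y r) / r
      else - (r1 * y r1 / r\<^sup>2))) (at r)"
    unfolding Y_def[abs_def]
  proof (rule DERIV_interior[OF ode_y])
    show "((\<lambda>r. r1 * y r1 / r) has_real_derivative - (r1 * y r1 / r\<^sup>2)) (at r)"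
      using r by (auto intro!: derivative_eq_intros simp: power2_eq_square)
  qed (use r r1 init final in \<open>auto simp: power2_eq_square\<close>)
  moreover have "(if r \<le> r1 then if r \<le> 1 then 0 else
      (K * (max 0 (1 - A r / r\<^sup>2))\<^sup>2 * (6 - 5 * max 0 (1 - A r / r\<^sup>2)) / A r - y r) / r
      else - (r1 * y r1 / r\<^sup>2)) = (K * (b r)\<^sup>2 * (6 - 5 * b r) / N r - Y r) / r"
  proof -
    consider "r \<le> 1" | "1 < r" "r \<le> r1" | "r1 < r" by linarith
    then show ?thesis
    proof cases
      case 1
      then show ?thesis using r r1 by (simp add: b_le_1 Y_def)
    next
      case 2
      then show ?thesis by (simp add: b_interior Y_def N_def)
    next
      case 3
      then show ?thesis using r1 by (simp add: b_def Y_def power2_eq_square)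
    qed
  qed
  ultimately show ?thesis by simp
qed

lemma N_deriv:
  assumes r: "0 < r"
  shows "(N has_real_derivative (K * b r ^ 3 + N r * Y r) / ((1 - Y r) * r)) (at r)"
proof -
  have y1: "1 - y r1 > 0" using y1_bounds by simp
  have "(N has_real_derivative (if r \<le> r1 then if r \<le> 1 then 0 else
      (K * (max 0 (1 - A r / r\<^sup>2)) ^ 3 + A r * y r) / ((1 - y r) * r)
      else r1\<^sup>2 * (r1 * y r1 / r\<^sup>2) / (1 - y r1))) (at r)"
    unfolding N_def[abs_def]
  proof (rule DERIV_interior[OF ode_A])
    show "((\<lambda>r. r1\<^sup>2 * (1 - r1 * y r1 / r) / (1 - y r1)) has_real_derivative
        r1\<^sup>2 * (r1 * y r1 / r\<^sup>2) / (1 - y r1)) (at r)"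
      using r y1 by (auto intro!: derivative_eq_intros simp: power2_eq_square mult_ac)
  qed (use r r1 init final y1 in \<open>auto simp: power2_eq_square\<close>)
  moreover have "(if r \<le> r1 then if r \<le> 1 then 0 else
      (K * (max 0 (1 - A r / r\<^sup>2)) ^ 3 + A r * y r) / ((1 - y r) * r)
      else r1\<^sup>2 * (r1 * y r1 / r\<^sup>2) / (1 - y r1)) = (K * b r ^ 3 + N r * Y r) / ((1 - Y r) * r)"
  proof -
    consider "r \<le> 1" | "1 < r" "r \<le> r1" | "r1 < r" by linarith
    then show ?thesis
    proof cases
      case 1
      then show ?thesis using r r1 by (simp add: b_le_1 Y_def)
    next
      case 2
      then show ?thesis by (simp add: b_interior Y_def N_def)
    next
      case 3
      have "N r = r1\<^sup>2 * (1 - Y r) / (1 - y r1)" using 3 by (simp add: N_def Y_def)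
      moreover have "1 - Y r \<noteq> 0" using Y_less[of r] by simp
      ultimately have "N r * Y r / ((1 - Y r) * r) = r1\<^sup>2 * (Y r / r) / (1 - y r1)"
        using y1 r by (simp add: divide_simps)
      then show ?thesis using 3 r1 by (simp add: b_def) (simp add: Y_def power2_eq_square)
    qed
  qed
  ultimately show ?thesis by simp
qed

text \<open>The natural formula for the density vanishes slightly beyond \<open>r1\<close>, so the cut-off at \<open>r1\<close> is smooth
  (further out, beyond the photon sphere, it would be positive again).\<close>

lemma N_exterior_edge:
  obtains r2 where "r1 < r2" "\<And>r. r1 \<le> r \<Longrightarrow> r < r2 \<Longrightarrow> r\<^sup>2 \<le> N r"
proof -
  let ?D = "(K * b r1 ^ 3 + N r1 * Y r1) / ((1 - Y r1) * r1) - 2 * r1"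
  have "((\<lambda>r. N r - r\<^sup>2) has_real_derivative ?D) (at r1)"
    using N_deriv[of r1] r1 by (auto intro!: derivative_eq_intros)
  moreover have "0 < ?D"
  proof -
    \<comment> \<open>This says \<open>y r1 > 2/3\<close>: the edge lies inside the photon sphere of
      the exterior, so \<open>N\<close> initially grows faster than
      \<open>r\<^sup>2\<close>.\<close>
    have "2 * (1 - y r1) < y r1" using y1_bounds(1) by simp
    then have "2 < y r1 / (1 - y r1)" using y1_bounds by (simp add: pos_less_divide_eq)
    then have "r1 * 2 < r1 * (y r1 / (1 - y r1))" using r1 by (intro mult_strict_left_mono) auto
    then show ?thesis using r1 by (simp add: Y_r1 N_r1 b_def power2_eq_square)
  qed
  ultimately obtain d where d: "d > 0" "\<And>h. 0 < h \<Longrightarrow> h < d \<Longrightarrow> N r1 - r1\<^sup>2 < N (r1 + h) - (r1 + h)\<^sup>2"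
    using DERIV_pos_inc_right by blast
  show thesis
  proof (rule that[of "r1 + d"])
    fix r assume r: "r1 \<le> r" "r < r1 + d"
    show "r\<^sup>2 \<le> N r"
      using d(2)[of "r - r1"] r by (cases "r = r1") (auto simp: N_r1)
  qed (use d in simp)
qed

text \<open>The rescaling of \<open>N\<close> makes
  \<open>exp (2 * mu r) = 1 - r1 * y r1 / r\<close> outside the shell, which gives the limit 0 at
  infinity.\<close>

definition "mu r = ln (N r * ((1 - y r1) / r1\<^sup>2)) / 2"
definition "lam r = - ln (1 - Y r) / 2"

lemma mu_deriv:
  assumes "0 < r"
  shows "(mu has_real_derivative (K * b r ^ 3 / N r + Y r) / (2 * (1 - Y r) * r)) (at r)"
proof -
  have pos: "0 < N r" "0 < 1 - Y r" "0 < (1 - y r1) / r1\<^sup>2"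
    using N_pos Y_less[of r] y1_bounds r1 by auto
  have "((\<lambda>r. N r * ((1 - y r1) / r1\<^sup>2)) has_real_derivative
      (K * b r ^ 3 + N r * Y r) / ((1 - Y r) * r) * ((1 - y r1) / r1\<^sup>2)) (at r)"
    by (rule DERIV_cmult_right[OF N_deriv[OF assms]])
  from DERIV_cdivide[OF DERIV_chain2[OF DERIV_ln_divide this], of 2] pos
  have "(mu has_real_derivative (1 / (N r * ((1 - y r1) / r1\<^sup>2)) *
      ((K * b r ^ 3 + N r * Y r) / ((1 - Y r) * r) * ((1 - y r1) / r1\<^sup>2))) / 2) (at r)"
    unfolding mu_def[abs_def] by (metis mult_pos_pos)
  moreover have "(1 / (N r * p) * (q / ((1 - Y r) * r) * p)) / 2 = q / N r / (2 * (1 - Y r) * r)"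
    if "0 < p" for p q
    using that pos assms by (simp add: field_simps)
  moreover have "(K * b r ^ 3 + N r * Y r) / N r = K * b r ^ 3 / N r + Y r"
    using pos by (simp add: field_simps)
  ultimately show ?thesis using pos(3) by metis
qed

lemma lam_deriv:
  assumes "0 < r"
  shows "(lam has_real_derivative (K * (b r)\<^sup>2 * (6 - 5 * b r) / N r - Y r) / (2 * (1 - Y r) * r)) (at r)"
proof -
  let ?d = "(K * (b r)\<^sup>2 * (6 - 5 * b r) / N r - Y r) / r"
  have pos: "0 < 1 - Y r" using Y_less[of r] by auto
  have "((\<lambda>r. 1 - Y r) has_real_derivative 0 - ?d) (at r)"
    by (intro DERIV_diff DERIV_const Y_deriv assms)
  from DERIV_cdivide[OF DERIV_minus[OF DERIV_chain2[OF DERIV_ln_divide[OF pos] this]], of 2]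
  have "(lam has_real_derivative - (1 / (1 - Y r) * (0 - ?d)) / 2) (at r)"
    unfolding lam_def[abs_def] .
  moreover have "- (1 / (1 - Y r) * (0 - q / r)) / 2 = q / (2 * (1 - Y r) * r)" for q
    using pos assms by (simp add: field_simps)
  ultimately show ?thesis by (rule DERIV_cong)
qed

lemma continuous_near_center:
  fixes f :: "real \<Rightarrow> real"
  assumes "\<And>r. 0 < r \<Longrightarrow> isCont f r" "\<And>r. r \<le> 1 \<Longrightarrow> f r = c"
  shows "continuous_on {0..} f"
proof (rule continuous_at_imp_continuous_on, intro ballI)
  fix r :: real assume "r \<in> {0..}"
  show "isCont f r"
  proof (cases "r = 0")
    case True
    have "((\<lambda>_. c) \<longlongrightarrow> c) (at (0::real))" by simp
    then have "(f \<longlongrightarrow> c) (at 0)"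
      by (rule Lim_transform_within_open[of _ _ _ _ "{..<1}"]) (use assms(2) in auto)
    then show ?thesis using True assms(2)[of 0] by (simp add: isCont_def)
  qed (use assms(1) \<open>r \<in> {0..}\<close> in auto)
qed

lemma continuous_mu: "continuous_on {0..} mu"
  by (rule continuous_near_center[of _ "mu 1"])
    (use r1 in \<open>auto intro: DERIV_isCont[OF mu_deriv] simp: mu_def N_def\<close>)

lemma continuous_lam: "continuous_on {0..} lam"
  by (rule continuous_near_center[of _ "lam 1"])
    (use r1 in \<open>auto intro: DERIV_isCont[OF lam_deriv] simp: lam_def Y_def\<close>)

lemma limits: "(mu \<longlongrightarrow> 0) at_top" "(lam \<longlongrightarrow> 0) at_top"
proof -
  have "((\<lambda>r. r1 * y r1 / r) \<longlongrightarrow> 0) at_top"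
    by (rule real_tendsto_divide_at_top[OF tendsto_const filterlim_ident])
  from tendsto_diff[OF tendsto_const this, of 1] have "((\<lambda>r. 1 - r1 * y r1 / r) \<longlongrightarrow> 1) at_top"
    by simp
  from tendsto_ln[OF this] have lim: "((\<lambda>r. ln (1 - r1 * y r1 / r)) \<longlongrightarrow> 0) at_top"
    by simp
  have ext: "\<forall>\<^sub>F r in at_top. r1 < r" by (rule eventually_gt_at_top)
  have "((\<lambda>r. ln (1 - r1 * y r1 / r) / 2) \<longlongrightarrow> 0) at_top"
    using tendsto_divide[OF lim tendsto_const, of 2] by simp
  then show "(mu \<longlongrightarrow> 0) at_top"
  proof (rule Lim_transform_eventually)
    show "\<forall>\<^sub>F r in at_top. ln (1 - r1 * y r1 / r) / 2 = mu r"
      using ext by eventually_elim (use r1 y1_bounds in \<open>simp add: mu_def N_def\<close>)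
  qed
  have "((\<lambda>r. - ln (1 - r1 * y r1 / r) / 2) \<longlongrightarrow> 0) at_top"
    using tendsto_divide[OF tendsto_minus[OF lim] tendsto_const, of 2] by simp
  then show "(lam \<longlongrightarrow> 0) at_top"
  proof (rule Lim_transform_eventually)
    show "\<forall>\<^sub>F r in at_top. - ln (1 - r1 * y r1 / r) / 2 = lam r"
      using ext by eventually_elim (simp add: lam_def Y_def)
  qed
qed

text \<open>The amplitude is normalised so that 8 pi r^2 p equals \<open>K * b r ^ 3 / N r\<close>,
  the source term of the shell equations.\<close>

definition "f = photon_density N r1 (K / (8 * pi * radial_moment))"

section \<open>Field equations for the glued solution\<close>

lemma rho_f:
  assumes "x \<noteq> 0"
  shows "8 * pi * (norm x)\<^sup>2 * rho f x = K * (b (norm x))\<^sup>2 * (6 - 5 * b (norm x)) / N (norm x)"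
proof (cases "norm x < r1")
  case True
  then have "rho f x = K / (8 * pi * radial_moment) * radial_moment * (b (norm x))\<^sup>2 * (6 - 5 * b (norm x))
      / (N (norm x) * (norm x)\<^sup>2)"
    unfolding f_def using assms by (intro rho_photon_density N_pos) (auto simp: b_def)
  then show ?thesis using assms radial_moment_pos by simp
next
  case False
  then show ?thesis by (simp add: f_def rho_def photon_density_def b_def)
qed

lemma prad_f:
  assumes "x \<noteq> 0"
  shows "8 * pi * (norm x)\<^sup>2 * prad f x = K * b (norm x) ^ 3 / N (norm x)"
proof (cases "norm x < r1")
  case True
  then have "prad f x = K / (8 * pi * radial_moment) * radial_moment * b (norm x) ^ 3
      / (N (norm x) * (norm x)\<^sup>2)"
    unfolding f_def using assms by (intro prad_photon_density N_pos) (auto simp: b_def)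
  then show ?thesis using assms radial_moment_pos by simp
next
  case False
  then show ?thesis by (simp add: f_def prad_def photon_density_def b_def)
qed

lemma exp_lam: "exp (-2 * lam r) = 1 - Y r"
  using Y_less[of r] by (simp add: lam_def)

lemma einstein_lam:
  assumes "x \<noteq> 0"
  shows "exp (-2 * lam (norm x)) * (2 * norm x * deriv lam (norm x) - 1) + 1 = 8 * pi * (norm x)\<^sup>2 * rho f x"
proof -
  have pos: "0 < norm x" "0 < 1 - Y (norm x)" using assms Y_less[of "norm x"] by auto
  have d: "deriv lam (norm x) = (K * (b (norm x))\<^sup>2 * (6 - 5 * b (norm x)) / N (norm x) - Y (norm x))
      / (2 * (1 - Y (norm x)) * norm x)"
    using lam_deriv[OF pos(1)] by (rule DERIV_imp_deriv)
  have "(1 - Y (norm x)) * (2 * norm x * ((q - Y (norm x)) / (2 * (1 - Y (norm x)) * norm x)) - 1) + 1 = q" for q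
    using pos by (simp add: field_simps)
  then show ?thesis unfolding exp_lam d rho_f[OF assms] .
qed

lemma einstein_mu:
  assumes "x \<noteq> 0"
  shows "exp (-2 * lam (norm x)) * (2 * norm x * deriv mu (norm x) + 1) - 1 = 8 * pi * (norm x)\<^sup>2 * prad f x"
proof -
  have pos: "0 < norm x" "0 < 1 - Y (norm x)" using assms Y_less[of "norm x"] by auto
  have d: "deriv mu (norm x) = (K * b (norm x) ^ 3 / N (norm x) + Y (norm x)) / (2 * (1 - Y (norm x)) * norm x)"
    using mu_deriv[OF pos(1)] by (rule DERIV_imp_deriv)
  have "(1 - Y (norm x)) * (2 * norm x * ((q + Y (norm x)) / (2 * (1 - Y (norm x)) * norm x)) + 1) - 1 = q" for q
    using pos by (simp add: field_simps)
  then show ?thesis unfolding exp_lam d prad_f[OF assms] .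
qed

lemma vlasov:
  assumes "x \<noteq> 0" "v \<noteq> 0"
  shows "\<exists>D. ((\<lambda>z. f (fst z) (snd z)) has_derivative D) (at (x, v)) \<and>
     D ((exp (mu (norm x) - lam (norm x)) / norm v) *\<^sub>R v,
       (- (exp (mu (norm x) - lam (norm x)) * norm v * deriv mu (norm x) / norm x)) *\<^sub>R x) = 0"
proof -
  have r: "0 < norm x" using assms by simp
  obtain r2 where "r1 < r2" "\<And>r. r1 \<le> r \<Longrightarrow> r < r2 \<Longrightarrow> r\<^sup>2 \<le> N r"
    by (rule N_exterior_edge) blast
  moreover have "(N has_real_derivative 2 * deriv mu (norm x) * N (norm x)) (at (norm x))"
  proof -
    have "2 * (((K * b (norm x) ^ 3 / N (norm x) + Y (norm x)) / (2 * (1 - Y (norm x)) * norm x))) * N (norm x)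
        = (K * b (norm x) ^ 3 + N (norm x) * Y (norm x)) / ((1 - Y (norm x)) * norm x)"
      using N_pos[of "norm x"] Y_less[of "norm x"] r by (simp add: field_simps)
    then show ?thesis using N_deriv[OF r] DERIV_imp_deriv[OF mu_deriv[OF r]] by simp
  qed
  ultimately show ?thesis
    unfolding f_def by (intro photon_density_vlasov assms N_pos)
qed

lemma f_nonneg: "0 < K \<Longrightarrow> 0 \<le> f x v"
  using radial_moment_pos N_pos[of "norm x"]
  by (auto simp: f_def photon_density_def intro!: divide_nonneg_nonneg mult_nonneg_nonneg emission_nonneg)

lemma ptan_integrable: "integrable lborel (\<lambda>v. (norm (cross3 x v) / norm x)\<^sup>2 * f x v / norm v)"
proof -
  have "continuous_on UNIV (\<lambda>v. (norm (cross3 x v) / norm x)\<^sup>2)"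
    unfolding power_divide norm_cross unfolding divide_inverse by (intro continuous_intros)
  from photon_density_div_norm_integrable[OF N_pos this] show ?thesis
    by (simp add: f_def mult.commute)
qed

lemma prad_integrable: "integrable lborel (\<lambda>v. f x v / norm v * ((x \<bullet> v) / norm x)\<^sup>2)"
proof -
  have "continuous_on UNIV (\<lambda>v. ((x \<bullet> v) / norm x)\<^sup>2)"
    unfolding divide_inverse by (intro continuous_intros)
  from photon_density_div_norm_integrable[OF N_pos this] show ?thesis
    by (simp add: f_def)
qed

lemma rho_integrable: "integrable lborel (\<lambda>v. f x v * norm v)"
  unfolding f_def by (intro photon_density_integrable N_pos continuous_intros)

lemma static_solution:
  assumes "0 < K"
  shows "static_massless_EV mu lam f"
  unfolding static_massless_EV_def
proof (intro conjI allI impI)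
  show "mu differentiable at r" "lam differentiable at r" if "0 < r" for r
    using mu_deriv[OF that] lam_deriv[OF that] by (auto simp: real_differentiable_def)
  show "f (Q *v x) (Q *v v) = f x v" if "rotation_matrix Q" for Q x v
    using that by (simp add: f_def photon_density_rotation)
  show "lam 0 = 0" using r1 by (simp add: lam_def Y_def)
  show "0 \<le> f x v" for x v using assms by (rule f_nonneg)
  show "integrable lborel (\<lambda>v. f x v / norm v * ((x \<bullet> v) / norm x)\<^sup>2)" for x by (rule prad_integrable)
  show "exp (-2 * lam (norm x)) * (2 * norm x * deriv lam (norm x) - 1) + 1 = 8 * pi * (norm x)\<^sup>2 * rho f x"
    "exp (-2 * lam (norm x)) * (2 * norm x * deriv mu (norm x) + 1) - 1 = 8 * pi * (norm x)\<^sup>2 * prad f x"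
    if "0 < norm x" for x using einstein_lam[of x] einstein_mu[of x] that by auto
qed (rule continuous_mu continuous_lam rho_integrable ptan_integrable vlasov limits; assumption?)+

lemma compact_support:
  assumes "r1 \<le> norm x"
  shows "rho f x = 0 \<and> prad f x = 0 \<and> ptan f x = 0"
  using assms by (simp add: f_def photon_density_def rho_def prad_def ptan_def)

section \<open>Mass function and compactness ratio\<close>

lemma mass_integral:
  assumes "0 \<le> r"
  shows "((\<lambda>s. s\<^sup>2 * rho_r f s) has_integral r * Y r / (8 * pi)) {0..r}"
proof -
  \<comment> \<open>\<open>s * Y s\<close> has derivative 8 pi s^2 rho; at 0 its continuity is used,
    since \<open>Y_deriv\<close> holds for positive radii.\<close>
  have "((\<lambda>s. s\<^sup>2 * rho_r f s) has_integral (r * Y r / (8 * pi) - 0 * Y 0 / (8 * pi))) {0..r}"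
  proof (rule fundamental_theorem_of_calculus_interior[OF assms])
    have "continuous_on {0..} Y"
      by (rule continuous_near_center[of _ 0]) (use r1 in \<open>auto intro: DERIV_isCont[OF Y_deriv] simp: Y_def\<close>)
    then show "continuous_on {0..r} (\<lambda>s. s * Y s / (8 * pi))"
      by (intro continuous_intros) (auto intro: continuous_on_subset)
    fix s assume "s \<in> {0<..<r}"
    then have s: "0 < s" by simp
    have "norm (axis 1 s :: real^3) = s" using s by (simp add: norm_eq_sqrt_inner inner_axis_axis)
    then have rho: "8 * pi * s\<^sup>2 * rho_r f s = K * (b s)\<^sup>2 * (6 - 5 * b s) / N s"
      using rho_f[of "axis 1 s"] s by (simp add: rho_r_def axis_eq_0_iff)
    have "((\<lambda>s. s * Y s / (8 * pi)) has_real_derivative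
      (1 * Y s + (K * (b s)\<^sup>2 * (6 - 5 * b s) / N s - Y s) / s * s) / (8 * pi)) (at s)"
      by (intro DERIV_cdivide DERIV_mult DERIV_ident Y_deriv s)
    moreover have "(1 * Y s + (K * (b s)\<^sup>2 * (6 - 5 * b s) / N s - Y s) / s * s) / (8 * pi) = s\<^sup>2 * rho_r f s"
      using s rho[symmetric] by simp
    ultimately show "((\<lambda>s. s * Y s / (8 * pi)) has_vector_derivative s\<^sup>2 * rho_r f s) (at s)"
      by (simp add: has_real_derivative_iff_has_vector_derivative)
  qed
  then show ?thesis by simp
qed

lemma compactness: "0 \<le> r \<Longrightarrow> 2 * mass f r / r = Y r"
  \<comment> \<open>At \<open>r = 0\<close> both sides are 0, the left one by the convention for
    division by zero.\<close>
  using integral_unique[OF mass_integral, of r] r1 by (cases "r = 0") (auto simp: mass_def Y_def)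

text \<open>Pointwise \<open>Y < 8/9\<close> only bounds the supremum weakly; strictness holds
  because the maximum is attained on \<open>{1..r1}\<close>, \<open>Y\<close> being 0 before and at
  most \<open>y r1\<close> beyond.\<close>

lemma sup_Y: "bdd_above (Y ` {0..})" "4/5 < (SUP r\<in>{0..}. Y r)" "(SUP r\<in>{0..}. Y r) < 8/9"
proof -
  have bdd: "bdd_above (Y ` {0..})"
    using Y_less by (intro bdd_aboveI2[of _ _ "8/9"]) (simp add: less_imp_le)
  then show "bdd_above (Y ` {0..})" .
  have "Y r1 \<le> (SUP r\<in>{0..}. Y r)" using r1 by (intro cSUP_upper bdd) auto
  then show "4/5 < (SUP r\<in>{0..}. Y r)" using Y_r1 final by simp
  have "continuous_on {1..r1} Y"
    using r1 by (intro continuous_at_imp_continuous_on ballI DERIV_isCont[OF Y_deriv]) auto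
  then obtain s where s: "s \<in> {1..r1}" "\<And>r. r \<in> {1..r1} \<Longrightarrow> Y r \<le> Y s"
    using continuous_attains_sup[of "{1..r1}" Y] r1 by auto
  have "Y r \<le> Y s" for r
  proof -
    consider "r \<le> 1" | "1 < r" "r \<le> r1" | "r1 < r" by linarith
    then show ?thesis
    proof cases
      case 1
      then show ?thesis using Y_nonneg[of s] r1 by (simp add: Y_def)
    next
      case 2
      then show ?thesis using s by simp
    next
      case 3
      then have "Y r \<le> Y r1" using exterior_Y_le[of r] by (simp add: Y_r1) (simp add: Y_def)
      then show ?thesis using s(2)[of r1] r1 by simp
    qed
  qed
  then have "(SUP r\<in>{0..}. Y r) \<le> Y s" by (intro cSUP_least) auto
  then show "(SUP r\<in>{0..}. Y r) < 8/9" using Y_less[of s] by simp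
qed

end

theorem theorem1:
  shows "\<exists>mu lam (f :: pdens).
    static_massless_EV mu lam f \<and>
    (\<exists>R. \<forall>x. norm x \<ge> R \<longrightarrow> rho f x = 0 \<and> prad f x = 0 \<and> ptan f x = 0) \<and>
    (\<forall>r\<ge>0. (\<lambda>s. s\<^sup>2 * rho_r f s) integrable_on {0..r}) \<and>
    bdd_above ((\<lambda>r. 2 * mass f r / r) ` {0..}) \<and>
    4/5 < (SUP r\<in>{0..}. 2 * mass f r / r) \<and>
    (SUP r\<in>{0..}. 2 * mass f r / r) < 8/9"
proof -
  define K :: real where "K = 10 ^ 12"
  obtain A y r1 where "photon_shell A y r1 K"
    by (rule shell_exists[OF K_def])
  then interpret photon_shell A y r1 K .
  have "(\<lambda>r. 2 * mass f r / r) ` {0..} = Y ` {0..}"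
    by (rule image_cong) (auto simp: compactness)
  then show ?thesis
    using static_solution compact_support mass_integral sup_Y
    by (intro exI[of _ mu] exI[of _ lam] exI[of _ f]) (auto simp: K_def has_integral_integrable)
qed

end
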